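(* Let $\omega(x,t)=\operatorname{curl}v(x,t)$ be the vorticity of a smooth solution $v(x,t)$ on $\mathbb{R}^3\times[0,T)$, $T\in(0,\infty]$, of the homogeneous incompressible Euler equations $$\frac{\partial v}{\partial t}+(v\cdot\nabla)v=-\nabla p,\qquad\operatorname{div}v=0,\qquad v(x,0)=v_0(x),$$ with initial vorticity $\omega_0=\operatorname{curl}v_0$ satisfying $\|\omega_0\|_{L^\infty}<\infty$. Let $\{X(\cdot,t)\}$ be the particle trajectory map and $A(\cdot,t)$ the back-to-label map generated by $v$. Set $\xi(x,t)=\frac{\omega(x,t)}{|\omega(x,t)|}$ (where $\omega\neq0$). Let $\{(\lambda_j(x,t),e_j(x,t))\}_{j=1}^3$ be the pairs of eigenvalues and normalized (orthonormal) eigenvectors of $M(x,t)=(\nabla A(x,t))^T\nabla A(x,t)$, ordered so that $\lambda_1(x,t)\ge\lambda_2(x,t)\ge\lambda_3(x,t)>0$. Suppose there exists a sequence $\{(x_k,t_k)\}$ in $\mathbb{R}^3\times[0,T)$ tending to some $(\bar x,\bar t)\in\mathbb{R}^3\times[0,T]$ as $k\to\infty$ such that $\lim_{k\to\infty}|\omega(x_k,t_k)|=\infty$. Then necessarily $$\lim_{k\to\infty}\lambda_1(x_k,t_k)=\infty\quad\text{and}\quad\lim_{k\to\infty}\lambda_3(x_k,t_k)=0,$$ and $$\lim_{k\to\infty}\xi(x_k,t_k)\cdot e_1(x_k,t_k)=0 .$$ Furthermore, if $\liminf_{k\to\infty}\lambda_2(x_k,t_k)>0$, then $$\lim_{k\to\infty}\xi(x_k,t_k)\cdot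 e_2(x_k,t_k)=0 .$$
   Context: $v=(v_1,v_2,v_3)$ is the velocity and $p=p(x,t)$ the scalar pressure. The particle trajectory map $X(\cdot,t)$ generated by $v$ is defined by $\frac{\partial X(a,t)}{\partial t}=v(X(a,t),t)$, $X(a,0)=a\in\mathbb{R}^3$; for each $t\in[0,T)$ it is a diffeomorphism of $\mathbb{R}^3$ (standing assumption), and the back-to-label map is its inverse $A(\cdot,t)=X^{-1}(\cdot,t)$. $\nabla A$ is the Jacobian matrix of $A(\cdot,t)$. *)

theory Defs
  imports "HOL-Probability.Probability"
begin

text \<open>
  Derivatives are taken within \<open>S\<close>, so that for
  \<open>S = UNIV \<times> {0..<T}\<close> the classes \<open>C\<^sup>k\<close> are regularity up to and including the
  boundary \<open>t = 0\<close>.  They are only meant for sets on which derivatives within \<open>S\<close> are unique,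
  such as convex sets with nonempty interior.
\<close>

primrec Ck_on ::
  "nat \<Rightarrow> 'a::euclidean_space set \<Rightarrow> ('a \<Rightarrow> 'b::euclidean_space) \<Rightarrow> bool" where
  "Ck_on 0 S f \<longleftrightarrow> continuous_on S f"
| "Ck_on (Suc k) S f \<longleftrightarrow>
     (\<exists>f'. (\<forall>x\<in>S. (f has_derivative f' x) (at x within S)) \<and>
           (\<forall>h. Ck_on k S (\<lambda>x. f' x h)))"

definition smooth_on :: "'a::euclidean_space set \<Rightarrow> ('a \<Rightarrow> 'b::euclidean_space) \<Rightarrow> bool" where
  "smooth_on S f \<longleftrightarrow> (\<forall>k. Ck_on k S f)"

definition diffeo :: "('a::euclidean_space \<Rightarrow> 'a) \<Rightarrow> bool" where
  "diffeo f \<longleftrightarrow> bij f \<and> smooth_on UNIV f \<and> smooth_on UNIV (inv f)"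

definition time_interval :: "ereal \<Rightarrow> real set" where
  "time_interval T = {t. 0 \<le> t \<and> ereal t < T}"

definition divergence :: "(real^3 \<Rightarrow> real^3) \<Rightarrow> real^3 \<Rightarrow> real" where
  "divergence u x = trace (jacobian u (at x))"

definition curl :: "(real^3 \<Rightarrow> real^3) \<Rightarrow> real^3 \<Rightarrow> real^3" where
  "curl u x = (let J = jacobian u (at x) in
     vector [J $ 3 $ 2 - J $ 2 $ 3, J $ 1 $ 3 - J $ 3 $ 1, J $ 2 $ 1 - J $ 1 $ 2])"

definition gradient :: "(real^3 \<Rightarrow> real) \<Rightarrow> real^3 \<Rightarrow> real^3" where
  "gradient q x = (\<chi> i. frechet_derivative q (at x) (axis i 1))"

definition Linf_norm :: "(real^3 \<Rightarrow> real^3) \<Rightarrow> ereal" where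
  "Linf_norm u = esssup lebesgue (\<lambda>x. ereal (norm (u x)))"

text \<open>
  The term \<open>(v \<bullet> \<nabla>) v\<close> is the Jacobian of \<open>v\<close> applied to \<open>v\<close>.
  The pressure is only required to have a spatial gradient; its smoothness
  in space then follows from the equation.  At \<open>t = 0\<close> the time derivative is one-sided.
\<close>

definition smooth_euler_solution ::
  "ereal \<Rightarrow> (real^3 \<Rightarrow> real^3) \<Rightarrow> (real^3 \<Rightarrow> real \<Rightarrow> real^3) \<Rightarrow> (real^3 \<Rightarrow> real \<Rightarrow> real) \<Rightarrow> bool" where
  "smooth_euler_solution T v0 v p \<longleftrightarrow>
     smooth_on (UNIV \<times> time_interval T) (\<lambda>(x, t). v x t) \<and>
     (\<forall>t\<in>time_interval T. \<forall>x.
        (\<lambda>y. p y t) differentiable (at x) \<and>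
        (\<exists>vt. ((\<lambda>s. v x s) has_vector_derivative vt) (at t within time_interval T) \<and>
              vt + jacobian (\<lambda>y. v y t) (at x) *v v x t = - gradient (\<lambda>y. p y t) x) \<and>
        divergence (\<lambda>y. v y t) x = 0) \<and>
     (\<forall>x. v x 0 = v0 x)"

definition vorticity :: "(real^3 \<Rightarrow> real \<Rightarrow> real^3) \<Rightarrow> real^3 \<Rightarrow> real \<Rightarrow> real^3" where
  "vorticity v x t = curl (\<lambda>y. v y t) x"

text \<open>Junk value \<open>0\<close> where the vorticity vanishes.\<close>

definition vorticity_direction :: "(real^3 \<Rightarrow> real \<Rightarrow> real^3) \<Rightarrow> real^3 \<Rightarrow> real \<Rightarrow> real^3" where
  "vorticity_direction v x t = vorticity v x t /\<^sub>R norm (vorticity v x t)"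

definition trajectory_map ::
  "ereal \<Rightarrow> (real^3 \<Rightarrow> real \<Rightarrow> real^3) \<Rightarrow> (real^3 \<Rightarrow> real \<Rightarrow> real^3) \<Rightarrow> bool" where
  "trajectory_map T v X \<longleftrightarrow>
     (\<forall>a. X a 0 = a) \<and>
     (\<forall>a. \<forall>t\<in>time_interval T.
        ((\<lambda>s. X a s) has_vector_derivative v (X a t) t) (at t within time_interval T))"

definition back_to_label :: "(real^3 \<Rightarrow> real \<Rightarrow> real^3) \<Rightarrow> real^3 \<Rightarrow> real \<Rightarrow> real^3" where
  "back_to_label X x t = inv (\<lambda>a. X a t) x"

definition label_metric :: "(real^3 \<Rightarrow> real \<Rightarrow> real^3) \<Rightarrow> real^3 \<Rightarrow> real \<Rightarrow> real^3^3" where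
  "label_metric A x t =
     (let J = jacobian (\<lambda>y. A y t) (at x) in transpose J ** J)"

text \<open>In the index type \<open>3\<close> the numeral \<open>3\<close> equals \<open>0\<close>, so the ordering is spelled out
  instead of being expressed by monotonicity.\<close>

definition ordered_eigensystem :: "real^3^3 \<Rightarrow> (3 \<Rightarrow> real) \<Rightarrow> (3 \<Rightarrow> real^3) \<Rightarrow> bool" where
  "ordered_eigensystem M lam e \<longleftrightarrow>
     (\<forall>j. M *v e j = lam j *\<^sub>R e j) \<and>
     (\<forall>i j. e i \<bullet> e j = (if i = j then 1 else 0)) \<and>
     lam 1 \<ge> lam 2 \<and> lam 2 \<ge> lam 3 \<and> lam 3 > 0"

end

theory Submission
  imports Defs
begin

text \<open>
  Write \<open>J\<close> for the differential of the flow map along a trajectory and \<open>G\<close> for the velocity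
  gradient there.  Then \<open>J' = G J\<close>, and \<open>G' + G\<^sup>2\<close> is symmetric because it is minus the Hessian
  of the pressure.  Hence \<open>J\<^sup>T (G - G\<^sup>T) J\<close> is constant in time, and so is
  \<open>det J\<close> because \<open>trace G = 0\<close>.  As \<open>G - G\<^sup>T\<close> is the cross product with the vorticity, this
  is Cauchy's formula \<open>\<nabla>A \<omega> = \<omega>\<^sub>0 \<circ> A\<close> together with \<open>det \<nabla>A = 1\<close>.  Expanding in the eigenbasis
  gives \<open>\<Sum>\<^sub>j \<lambda>\<^sub>j (\<omega> \<bullet> e\<^sub>j)\<^sup>2 = \<bar>\<omega>\<^sub>0 \<circ> A\<bar>\<^sup>2\<close>, which stays bounded while \<open>\<bar>\<omega>\<bar> \<rightarrow> \<infinity>\<close>, and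
  \<open>\<lambda>\<^sub>1 \<lambda>\<^sub>2 \<lambda>\<^sub>3 = 1\<close>.
\<close>

section \<open>Symmetry of second derivatives\<close>

text \<open>The second difference of \<open>f\<close> over the parallelogram spanned by
  \<open>s h\<close> and \<open>s k\<close> is symmetric in \<open>h\<close> and \<open>k\<close>.
  Divided by \<open>s^2\<close> it tends to \<open>Dh k\<close> when the mean value theorem is
  applied along \<open>h\<close>, and to \<open>Dk h\<close> when it is applied along
  \<open>k\<close>. Second derivatives are asked for at \<open>x\<close> alone, which is what will
  be available for the pressure.\<close>

lemma symmetric_second_derivative:
  fixes f :: "'a::real_normed_vector \<Rightarrow> real"
  assumes "open S" "x \<in> S"
    and f': "\<And>y. y \<in> S \<Longrightarrow> (f has_derivative f' y) (at y)"
    and Dh: "((\<lambda>y. f' y h) has_derivative Dh) (at x)"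
    and Dk: "((\<lambda>y. f' y k) has_derivative Dk) (at x)"
  shows "Dh k = Dk h"
proof -
  define \<Delta> where "\<Delta> h k s = f (x + s *\<^sub>R h + s *\<^sub>R k) - f (x + s *\<^sub>R h) - f (x + s *\<^sub>R k) + f x"
    for h k :: 'a and s :: real
  \<comment> \<open>Stated for arbitrary directions, so that it can be used for
    \<open>(h, k)\<close> and for \<open>(k, h)\<close>.\<close>
  have approx: "\<forall>\<^sub>F s in at_right 0. \<bar>\<Delta> h k s - s * s * Dh k\<bar> \<le> e * (s * s)"
    if Dh: "((\<lambda>y. f' y h) has_derivative Dh) (at x)" and "e > 0" for h k Dh and e :: real
  proof -
    interpret Dh: bounded_linear Dh using Dh by (rule has_derivative_bounded_linear)
    \<comment> \<open>With \<open>p\<close> and \<open>q\<close> as defined below,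
      \<open>norm p + norm q \<le> s * N\<close>; the summand 1 keeps \<open>N\<close> positive when
      \<open>h\<close> and \<open>k\<close> vanish.\<close>
    define N where "N = 2 * norm h + norm k + 1"
    have N: "N > 0" by (simp add: N_def add_nonneg_pos)
    then have "e / N > 0" using \<open>e > 0\<close> by simp
    with Dh obtain d where d: "d > 0"
      and err: "\<And>y. norm (y - x) < d \<Longrightarrow> \<bar>f' y h - f' x h - Dh (y - x)\<bar> \<le> e / N * norm (y - x)"
      unfolding has_derivative_at_alt by (auto simp: real_norm_def)
    obtain r where r: "r > 0" "ball x r \<subseteq> S"
      using \<open>open S\<close> \<open>x \<in> S\<close> open_contains_ball by blast
    \<comment> \<open>Small enough for the whole parallelogram to lie in \<open>S\<close> and within
      the radius \<open>d\<close> of \<open>err\<close>.\<close>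
    define \<delta> where "\<delta> = min d r / N"
    have "\<delta> > 0" using d r N by (simp add: \<delta>_def)
    show ?thesis
      unfolding eventually_at_right_field
    proof (intro exI[of _ \<delta>] conjI allI impI \<open>\<delta> > 0\<close>)
      fix s :: real assume s: "0 < s" "s < \<delta>"
      have near: "norm (\<tau> *\<^sub>R h + \<sigma> *\<^sub>R k) \<le> s * (norm h + norm k)"
        if "0 \<le> \<tau>" "\<tau> \<le> s" "0 \<le> \<sigma>" "\<sigma> \<le> s" for \<tau> \<sigma>
      proof -
        have "norm (\<tau> *\<^sub>R h + \<sigma> *\<^sub>R k) \<le> \<tau> * norm h + \<sigma> * norm k"
          using norm_triangle_ineq[of "\<tau> *\<^sub>R h" "\<sigma> *\<^sub>R k"] that by simp
        also have "\<dots> \<le> s * norm h + s * norm k"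
          using that by (intro add_mono mult_right_mono) auto
        finally show ?thesis by (simp add: algebra_simps)
      qed
      have "s * N < min d r"
        using s N by (simp add: \<delta>_def pos_less_divide_eq)
      moreover have "s * (norm h + norm k) \<le> s * N"
        using s by (intro mult_left_mono) (auto simp: N_def)
      ultimately have small: "s * (norm h + norm k) < d" "s * (norm h + norm k) < r" by auto
      have inS: "x + (\<tau> *\<^sub>R h + \<sigma> *\<^sub>R k) \<in> S" if "0 \<le> \<tau>" "\<tau> \<le> s" "0 \<le> \<sigma>" "\<sigma> \<le> s" for \<tau> \<sigma>
      proof -
        have "norm (\<tau> *\<^sub>R h + \<sigma> *\<^sub>R k) < r" using near[OF that] small by linarith
        then have "x + (\<tau> *\<^sub>R h + \<sigma> *\<^sub>R k) \<in> ball x r" by (simp only: mem_ball dist_norm norm_minus_commute[of x] add_diff_cancel_left')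
        with r show ?thesis by blast
      qed
      \<comment> \<open>\<open>g\<close> is the increment of \<open>f\<close> along
        \<open>s k\<close>, so \<open>g s - g 0\<close> is the second difference and the mean value
        theorem brings in only derivatives in direction \<open>h\<close>. The term
        \<open>0 *\<^sub>R k\<close> lets \<open>line\<close> serve both sides.\<close>
      define g where "g \<tau> = f (x + (\<tau> *\<^sub>R h + s *\<^sub>R k)) - f (x + (\<tau> *\<^sub>R h + 0 *\<^sub>R k))" for \<tau>
      define g' where "g' \<tau> = f' (x + (\<tau> *\<^sub>R h + s *\<^sub>R k)) h - f' (x + (\<tau> *\<^sub>R h + 0 *\<^sub>R k)) h" for \<tau>
      have line: "((\<lambda>\<tau>. f (x + (\<tau> *\<^sub>R h + \<sigma> *\<^sub>R k))) has_real_derivative f' (x + (\<tau> *\<^sub>R h + \<sigma> *\<^sub>R k)) h) (at \<tau>)"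
        if "0 \<le> \<tau>" "\<tau> \<le> s" "0 \<le> \<sigma>" "\<sigma> \<le> s" for \<tau> \<sigma>
      proof -
        let ?y = "x + (\<tau> *\<^sub>R h + \<sigma> *\<^sub>R k)"
        have D: "(f has_derivative f' ?y) (at ?y)" by (rule f'[OF inS[OF that]])
        interpret bounded_linear "f' ?y" using D by (rule has_derivative_bounded_linear)
        have "((\<lambda>\<tau>. x + (\<tau> *\<^sub>R h + \<sigma> *\<^sub>R k)) has_derivative (\<lambda>r. r *\<^sub>R h)) (at \<tau>)"
          by (auto intro!: derivative_eq_intros)
        from has_derivative_compose[OF this D]
        show ?thesis unfolding has_field_derivative_def
          by (rule has_derivative_eq_rhs) (auto simp: scaleR)
      qed
      have "\<exists>z. 0 < z \<and> z < s \<and> g s - g 0 = (s - 0) * g' z"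
        unfolding g_def g'_def
        by (rule MVT2[OF \<open>0 < s\<close>], rule DERIV_diff[OF line line]) (use s in auto)
      then obtain z where z: "0 < z" "z < s" and eq: "g s - g 0 = s * g' z" by auto
      have \<Delta>: "\<Delta> h k s = s * g' z" using eq by (simp add: g_def \<Delta>_def add.assoc)
      define p q where "p = z *\<^sub>R h + s *\<^sub>R k" and "q = z *\<^sub>R h"
      have np: "norm p \<le> s * (norm h + norm k)" using near[of z s] z by (simp add: p_def)
      have nq: "norm q \<le> s * norm h" using z by (simp add: q_def mult_right_mono)
      have nq': "norm q < d"
      proof -
        have "s * norm h \<le> s * (norm h + norm k)" using s by (intro mult_left_mono) auto
        then show ?thesis using nq small by linarith
      qed
      have "Dh p - Dh q = s * Dh k" by (simp add: p_def q_def Dh.add Dh.scaleR)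
      moreover have "\<bar>f' (x + p) h - f' x h - Dh p\<bar> \<le> e / N * norm p"
        using err[of "x + p"] np small by simp
      moreover have "\<bar>f' (x + q) h - f' x h - Dh q\<bar> \<le> e / N * norm q"
        using err[of "x + q"] nq' by simp
      ultimately have "\<bar>g' z - s * Dh k\<bar> \<le> e / N * (norm p + norm q)"
        unfolding g'_def p_def q_def by (simp add: distrib_left)
      also have "\<dots> \<le> e / N * (s * N)"
        using np nq s \<open>e / N > 0\<close> by (intro mult_left_mono) (auto simp: N_def algebra_simps)
      also have "\<dots> = e * s" using N by simp
      finally have "s * \<bar>g' z - s * Dh k\<bar> \<le> s * (e * s)" using s by simp
      also have "s * \<bar>g' z - s * Dh k\<bar> = \<bar>\<Delta> h k s - s * s * Dh k\<bar>"
        using s unfolding \<Delta> by (simp add: abs_mult[of s, simplified abs_of_pos[OF s(1)], symmetric] algebra_simps)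
      finally show "\<bar>\<Delta> h k s - s * s * Dh k\<bar> \<le> e * (s * s)" by (simp add: algebra_simps)
    qed
  qed
  have "\<bar>Dh k - Dk h\<bar> \<le> e" if "e > 0" for e
  proof -
    have "\<forall>\<^sub>F s in at_right (0::real). \<bar>Dh k - Dk h\<bar> \<le> e"
      using approx[OF Dh half_gt_zero[OF that], of k] approx[OF Dk half_gt_zero[OF that], of h]
        eventually_at_right_less[of 0]
    proof eventually_elim
      case (elim s)
      have "\<Delta> k h s = \<Delta> h k s" by (simp add: \<Delta>_def algebra_simps)
      with elim have "\<bar>s * s * Dh k - s * s * Dk h\<bar> \<le> e * (s * s)" by linarith
      moreover have "\<bar>s * s * Dh k - s * s * Dk h\<bar> = \<bar>Dh k - Dk h\<bar> * (s * s)"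
        using elim by (simp add: right_diff_distrib[symmetric] abs_mult)
      ultimately show ?case using elim by simp
    qed
    then show ?thesis by (simp add: eventually_const)
  qed
  then show ?thesis using field_le_epsilon[of "\<bar>Dh k - Dk h\<bar>" 0] by simp
qed

section \<open>Invariants of the linearized flow\<close>

lemma bounded_bilinear_matrix_vector_mult:
  "bounded_bilinear ((*v) :: real^'n^'m \<Rightarrow> real^'n \<Rightarrow> real^'m)"
  unfolding bilinear_conv_bounded_bilinear[symmetric] bilinear_def
  by (auto intro!: linearI simp: matrix_vector_mult_add_rdistrib matrix_vector_right_distrib
      matrix_vector_mult_scaleR scaleR_matrix_vector_assoc)

lemma has_vector_derivative_vec_componentwise:
  fixes f :: "real \<Rightarrow> 'a::euclidean_space^'n"
  assumes "\<And>i. ((\<lambda>s. f s $ i) has_vector_derivative f' $ i) (at t within S)"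
  shows "(f has_vector_derivative f') (at t within S)"
  unfolding has_vector_derivative_def
proof (subst has_derivative_componentwise_within, intro ballI)
  fix b :: "'a^'n" assume "b \<in> Basis"
  then obtain i u where "b = axis i u" by (auto simp: Basis_vec_def)
  moreover have "((\<lambda>s. f s $ i \<bullet> u) has_derivative (\<lambda>r. (r *\<^sub>R f' $ i) \<bullet> u)) (at t within S)"
    using assms[of i] unfolding has_vector_derivative_def by (rule has_derivative_inner_left)
  ultimately show "((\<lambda>s. f s \<bullet> b) has_derivative (\<lambda>r. (r *\<^sub>R f') \<bullet> b)) (at t within S)"
    by (simp add: inner_axis)
qed

lemma inner_transpose_matrix_vector:
  "(transpose A *v x) \<bullet> y = x \<bullet> (A *v y)" for A :: "real^'n^'m"
  by (simp add: dot_lmul_matrix)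

text \<open>Differentiating \<open>a \<bullet> (G b)\<close> gives
  \<open>(G a) \<bullet> (G b) + a \<bullet> ((B + G^2) b)\<close>. Both terms are symmetric in
  \<open>a\<close> and \<open>b\<close>, hence cancel in the antisymmetrized expression.\<close>

lemma cauchy_invariant_derivative:
  fixes a b :: "real \<Rightarrow> real^3" and G :: "real \<Rightarrow> real^3^3"
  assumes a: "(a has_vector_derivative G t *v a t) (at t)"
    and b: "(b has_vector_derivative G t *v b t) (at t)"
    and G: "(G has_vector_derivative B) (at t)"
    and sym: "transpose (B + G t ** G t) = B + G t ** G t"
  shows "((\<lambda>s. a s \<bullet> (G s *v b s) - b s \<bullet> (G s *v a s)) has_vector_derivative 0) (at t)"
proof -
  note mult = bounded_bilinear.has_vector_derivative[OF bounded_bilinear_matrix_vector_mult]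
  note inner = bounded_bilinear.has_vector_derivative[OF bounded_bilinear_inner]
  have "a t \<bullet> ((B + G t ** G t) *v b t) = b t \<bullet> ((B + G t ** G t) *v a t)"
    by (metis sym inner_transpose_matrix_vector inner_commute)
  then show ?thesis
    by (intro has_vector_derivative_eq_rhs[OF has_vector_derivative_diff[OF
          inner[OF a mult[OF G b]] inner[OF b mult[OF G a]]]])
      (simp add: matrix_vector_mult_add_rdistrib matrix_vector_mul_assoc inner_add_right inner_commute)
qed

section \<open>Conservation of volume and the pullback of the vorticity\<close>

unbundle cross3_syntax

text \<open>The triple product is the determinant with rows \<open>a\<close>, \<open>b\<close>,
  \<open>c\<close>; this is the infinitesimal form of the multiplicativity of determinants, checked
  in coordinates.\<close>

lemma triple_product_trace:
  fixes G :: "real^3^3"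
  shows "(G *v a) \<bullet> (b \<times> c) + a \<bullet> ((G *v b) \<times> c) + a \<bullet> (b \<times> (G *v c)) = trace G * (a \<bullet> (b \<times> c))"
  by (simp add: cross3_simps matrix_vector_mult_def trace_def)

text \<open>Liouville's formula. \<open>G\<close> is the coefficient matrix at the instant
  \<open>t\<close>; when its trace vanishes, the volume is stationary.\<close>

lemma triple_product_derivative:
  fixes a b c :: "real \<Rightarrow> real^3"
  assumes a: "(a has_vector_derivative G *v a t) (at t)"
    and b: "(b has_vector_derivative G *v b t) (at t)"
    and c: "(c has_vector_derivative G *v c t) (at t)"
  shows "((\<lambda>s. a s \<bullet> (b s \<times> c s)) has_vector_derivative trace G * (a t \<bullet> (b t \<times> c t))) (at t)"
proof -
  have "bounded_bilinear (\<times>)"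
    using bilinear_cross by (simp add: bilinear_conv_bounded_bilinear)
  note cross = bounded_bilinear.has_vector_derivative[OF this]
  note inner = bounded_bilinear.has_vector_derivative[OF bounded_bilinear_inner]
  show ?thesis
    by (intro has_vector_derivative_eq_rhs[OF inner[OF a cross[OF b c]]])
      (simp add: triple_product_trace[symmetric] inner_add_right)
qed

text \<open>Identifies the quantity conserved by \<open>cauchy_invariant_derivative\<close> as a
  triple product with the vorticity.\<close>

lemma jacobian_antisymmetric_part:
  "a \<bullet> (jacobian u (at x) *v b) - b \<bullet> (jacobian u (at x) *v a) = a \<bullet> (curl u x \<times> b)"
  by (simp add: cross3_simps matrix_vector_mult_def curl_def Let_def)

text \<open>As \<open>w = J (K w)\<close>, \<open>vol\<close> turns the left side of
  \<open>form\<close> into \<open>h \<bullet> ((K w) \<times> k)\<close>, so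
  \<open>w\<^sub>0\<close> and \<open>K w\<close> have the same cross products. Later
  \<open>J\<close> is the differential of the flow and \<open>K\<close> that of the back-to-label
  map.\<close>

lemma pullback_by_unimodular:
  fixes J K :: "real^3^3"
  assumes vol: "\<And>h k l. (J *v h) \<bullet> ((J *v k) \<times> (J *v l)) = h \<bullet> (k \<times> l)"
    and form: "\<And>h k. (J *v h) \<bullet> (w \<times> (J *v k)) = h \<bullet> (w\<^sub>0 \<times> k)"
    and JK: "J ** K = mat 1"
  shows "K *v w = w\<^sub>0" "det K = 1"
proof -
  have "h \<bullet> (w\<^sub>0 \<times> k) = h \<bullet> ((K *v w) \<times> k)" for h k
    using form[of h k] vol[of h "K *v w" k] JK by (simp add: matrix_vector_mul_assoc)
  then have "w\<^sub>0 \<times> k = (K *v w) \<times> k" for k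
    using vector_eq_ldot by blast
  from this[of "axis 1 1"] this[of "axis 2 1"] show "K *v w = w\<^sub>0"
    by (simp add: cross3_simps axis_def forall_3)
  \<comment> \<open>The cofactor identity \<open>cross_matrix_mult\<close> shows that
    \<open>J\<close> multiplies triple products by its determinant.\<close>
  have "(J *v h) \<bullet> ((J *v k) \<times> (J *v l)) = det J * (h \<bullet> (k \<times> l))" for h k l
  proof -
    have "(J *v h) \<bullet> ((J *v k) \<times> (J *v l)) = (transpose J *v ((J *v k) \<times> (J *v l))) \<bullet> h"
      unfolding inner_transpose_matrix_vector by (rule inner_commute)
    then show ?thesis unfolding cross_matrix_mult by (simp add: inner_commute)
  qed
  from this[of "axis 1 1" "axis 2 1" "axis 3 1"] have "det J = 1"
    unfolding vol by (simp add: cross_basis inner_axis_axis)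
  with JK show "det K = 1" by (metis det_I det_mul mult_1)
qed

unbundle no cross3_syntax

section \<open>The variational equation of a flow\<close>

text \<open>The Lipschitz bound holds only in the unit tube about \<open>z\<close>. While
  \<open>u\<close> stays there, \<open>exp (- (2 * L * s))\<close> times the squared distance does
  not increase, and \<open>small\<close> keeps the resulting bound below 1, so \<open>u\<close>
  never leaves the tube.\<close>

lemma gronwall_trajectories:
  fixes f :: "'a::real_inner \<Rightarrow> real \<Rightarrow> 'a"
  assumes u: "\<And>s. s \<in> {0..\<tau>} \<Longrightarrow> (u has_vector_derivative f (u s) s) (at s within {0..\<tau>})"
    and z: "\<And>s. s \<in> {0..\<tau>} \<Longrightarrow> (z has_vector_derivative f (z s) s) (at s within {0..\<tau>})"
    and lip: "\<And>s y. \<lbrakk>s \<in> {0..\<tau>}; norm (y - z s) \<le> 1\<rbrakk> \<Longrightarrow> norm (f y s - f (z s) s) \<le> L * norm (y - z s)"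
    and small: "norm (u 0 - z 0) * exp (L * \<tau>) < 1" and L: "L \<ge> 0" and s: "s \<in> {0..\<tau>}"
  shows "norm (u s - z s) \<le> norm (u 0 - z 0) * exp (L * s)"
proof -
  \<comment> \<open>The square is differentiable even where \<open>u\<close> and \<open>z\<close>
    meet.\<close>
  define d where "d s = (u s - z s) \<bullet> (u s - z s)" for s
  define \<phi> where "\<phi> s = exp (- (2 * L * s)) * d s" for s
  have d_norm: "d s = (norm (u s - z s))\<^sup>2" for s by (simp add: d_def power2_norm_eq_inner)
  have uz: "continuous_on {0..\<tau>} u" "continuous_on {0..\<tau>} z"
    using has_vector_derivative_continuous[OF u] has_vector_derivative_continuous[OF z]
    by (auto simp: continuous_on_eq_continuous_within)
  then have cont: "continuous_on {0..\<tau>} (\<lambda>s. u s - z s)"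
    by (intro continuous_intros)
  have cont\<phi>: "continuous_on {0..\<tau>} \<phi>"
    unfolding \<phi>_def d_def by (intro continuous_intros uz)
  have bound: "norm (u \<sigma> - z \<sigma>) \<le> norm (u 0 - z 0) * exp (L * \<sigma>)"
    if \<sigma>: "\<sigma> \<in> {0..\<tau>}" and near: "\<And>s. 0 < s \<Longrightarrow> s < \<sigma> \<Longrightarrow> norm (u s - z s) \<le> 1" for \<sigma>
  proof -
    have "\<phi> \<sigma> \<le> \<phi> 0"
    \<comment> \<open>The open-interval criterion fits because the endpoints of
      \<open>{0..\<tau>}\<close> offer only one-sided derivatives.\<close>
    proof (rule DERIV_nonpos_imp_decreasing_open[of 0 \<sigma> \<phi>])
      show "continuous_on {0..\<sigma>} \<phi>" using cont\<phi> by (rule continuous_on_subset) (use \<sigma> in auto)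
      show "0 \<le> \<sigma>" using \<sigma> by simp
    next
      fix s assume s: "0 < s" "s < \<sigma>"
      then have "s \<in> interior {0..\<tau>}" using \<sigma> by simp
      then have at: "at s within {0..\<tau>} = at s" by (rule at_within_interior)
      have s\<tau>: "s \<in> {0..\<tau>}" using s \<sigma> by simp
      let ?w = "u s - z s" and ?f = "f (u s) s - f (z s) s"
      have w: "((\<lambda>s. u s - z s) has_vector_derivative ?f) (at s)"
        using has_vector_derivative_diff[OF u[OF s\<tau>] z[OF s\<tau>]] by (simp add: at)
      have "(d has_real_derivative 2 * (?w \<bullet> ?f)) (at s)"
        unfolding d_def has_real_derivative_iff_has_vector_derivative
        by (rule has_vector_derivative_eq_rhs[OF bounded_bilinear.has_vector_derivative[OF bounded_bilinear_inner w w]])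
          (simp add: inner_commute)
      then have "(\<phi> has_real_derivative exp (- (2 * L * s)) * (2 * (?w \<bullet> ?f) - 2 * L * d s)) (at s)"
        unfolding \<phi>_def by (auto intro!: derivative_eq_intros simp: algebra_simps)
      moreover have "?w \<bullet> ?f \<le> L * d s"
      proof -
        have "?w \<bullet> ?f \<le> norm ?w * norm ?f" by (rule norm_cauchy_schwarz)
        also have "\<dots> \<le> norm ?w * (L * norm ?w)"
          by (intro mult_left_mono lip s\<tau> near s) simp
        finally show ?thesis by (simp add: d_norm power2_eq_square algebra_simps)
      qed
      then have "exp (- (2 * L * s)) * (2 * (?w \<bullet> ?f) - 2 * L * d s) \<le> 0"
        by (simp add: mult_le_0_iff)
      ultimately show "\<exists>y. (\<phi> has_real_derivative y) (at s) \<and> y \<le> 0" by blast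
    qed
    then have "exp (- (2 * L * \<sigma>)) * d \<sigma> \<le> d 0" by (simp add: \<phi>_def)
    then have "exp (2 * L * \<sigma>) * (exp (- (2 * L * \<sigma>)) * d \<sigma>) \<le> exp (2 * L * \<sigma>) * d 0"
      by (intro mult_left_mono) auto
    then have "d \<sigma> \<le> exp (2 * L * \<sigma>) * d 0"
      by (simp add: mult.assoc[symmetric] exp_add[symmetric])
    also have "\<dots> = (norm (u 0 - z 0) * exp (L * \<sigma>))\<^sup>2"
      by (simp add: d_norm power_mult_distrib exp_double[symmetric] mult.assoc)
    finally show ?thesis unfolding d_norm by (rule power2_le_imp_le) simp
  qed
  have "norm (u s - z s) < 1" if "s \<in> {0..\<tau>}" for s
  proof (rule ccontr)
    \<comment> \<open>\<open>Inf S\<close> is the first exit time from the open tube; the bound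
      holds up to that time and contradicts \<open>small\<close>.\<close>
    define S where "S = {s \<in> {0..\<tau>}. 1 \<le> norm (u s - z s)}"
    assume "\<not> norm (u s - z s) < 1"
    then have "S \<noteq> {}" using that by (auto simp: S_def)
    moreover have "S = {0..\<tau>} \<inter> (\<lambda>s. norm (u s - z s)) -` {1..}" by (auto simp: S_def)
    then have "closed S"
      using continuous_closed_preimage[OF continuous_on_norm[OF cont] closed_atLeastAtMost closed_atLeast]
      by metis
    moreover have bdd: "bdd_below S" by (auto simp: S_def intro!: bdd_belowI[of _ 0])
    ultimately have Inf: "Inf S \<in> S" by (intro closed_contains_Inf)
    have "norm (u s - z s) \<le> 1" if "0 < s" "s < Inf S" for s
    proof (rule ccontr)
      assume "\<not> norm (u s - z s) \<le> 1"
      then have "s \<in> S" using that Inf by (auto simp: S_def)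
      then show False using cInf_lower[OF _ bdd, of s] that by simp
    qed
    then have "norm (u (Inf S) - z (Inf S)) \<le> norm (u 0 - z 0) * exp (L * Inf S)"
      using Inf by (intro bound) (auto simp: S_def)
    then have "1 \<le> norm (u 0 - z 0) * exp (L * Inf S)" and "Inf S \<le> \<tau>"
      using Inf by (auto simp: S_def)
    moreover from this L have "norm (u 0 - z 0) * exp (L * Inf S) \<le> norm (u 0 - z 0) * exp (L * \<tau>)"
      by (intro mult_left_mono) (auto intro!: mult_left_mono)
    ultimately show False using small by linarith
  qed
  then show ?thesis using bound[OF s] s by (meson atLeastAtMost_iff less_imp_le order_trans)
qed

text \<open>Continuity is known for \<open>Df x s h\<close> with \<open>h\<close> fixed, so the
  derivative is bounded on the compact set one basis vector at a time. The sum of these bounds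
  dominates the operator norm, and convexity of the ball yields a Lipschitz constant uniform in
  \<open>s\<close>.\<close>

lemma lipschitz_on_compact_tube:
  fixes f :: "'a::euclidean_space \<Rightarrow> real \<Rightarrow> 'b::euclidean_space"
  assumes f: "\<And>x s. s \<in> I \<Longrightarrow> ((\<lambda>y. f y s) has_derivative Df x s) (at x)"
    and cont: "\<And>h. continuous_on (UNIV \<times> I) (\<lambda>(x, s). Df x s h)" and "compact I"
  obtains L where "L \<ge> 0"
    "\<And>x y s. \<lbrakk>x \<in> cball 0 R; y \<in> cball 0 R; s \<in> I\<rbrakk> \<Longrightarrow> norm (f x s - f y s) \<le> L * norm (x - y)"
proof -
  have "\<exists>B. \<forall>(x, s) \<in> cball 0 R \<times> I. norm (Df x s h) \<le> B" for h
  proof -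
    have "compact ((\<lambda>(x, s). Df x s h) ` (cball 0 R \<times> I))"
      using continuous_on_subset[OF cont, of "cball 0 R \<times> I"] \<open>compact I\<close>
      by (intro compact_continuous_image compact_Times) auto
    then have "bounded ((\<lambda>(x, s). Df x s h) ` (cball 0 R \<times> I))" by (rule compact_imp_bounded)
    then show ?thesis unfolding bounded_iff by fast
  qed
  then obtain B where B: "norm (Df x s h) \<le> B h" if "x \<in> cball 0 R" "s \<in> I" for x s h
    by (metis (mono_tags, lifting) SigmaI case_prodD)
  show ?thesis
  proof
    show "(\<Sum>b\<in>Basis. \<bar>B b\<bar>) \<ge> 0" by (intro sum_nonneg) auto
    fix x y :: 'a and s :: real assume *: "x \<in> cball 0 R" "y \<in> cball 0 R" "s \<in> I"
    show "norm (f x s - f y s) \<le> (\<Sum>b\<in>Basis. \<bar>B b\<bar>) * norm (x - y)"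
    proof (rule differentiable_bound[OF convex_cball _ _ *(1,2)])
      fix x :: 'a assume x: "x \<in> cball 0 R"
      show "((\<lambda>x. f x s) has_derivative Df x s) (at x within cball 0 R)"
        using f[OF *(3)] by (rule has_derivative_at_withinI)
      show "onorm (Df x s) \<le> (\<Sum>b\<in>Basis. \<bar>B b\<bar>)"
        using B[OF x *(3)]
        by (intro onorm_componentwise_le has_derivative_bounded_linear[OF f[OF *(3)]] sum_mono)
          (meson abs_ge_self order_trans)
    qed
  qed
qed

text \<open>The difference quotients of the flow at a fixed label are bounded by Gronwall's inequality,
  so that dominated convergence passes to the limit in the integrated trajectory equation.\<close>

lemma flow_variation:
  fixes f :: "'a::euclidean_space \<Rightarrow> real \<Rightarrow> 'a"
  assumes f: "\<And>x s. s \<in> {0..\<tau>} \<Longrightarrow> ((\<lambda>y. f y s) has_derivative Df x s) (at x)"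
    and cont: "\<And>h. continuous_on (UNIV \<times> {0..\<tau>}) (\<lambda>(x, s). Df x s h)"
    and start: "\<And>a. \<Phi> a 0 = a"
    and flow: "\<And>a s. s \<in> {0..\<tau>} \<Longrightarrow> (\<Phi> a has_vector_derivative f (\<Phi> a s) s) (at s within {0..\<tau>})"
    and D\<Phi>: "\<And>s. s \<in> {0..\<tau>} \<Longrightarrow> ((\<lambda>a. \<Phi> a s) has_derivative D\<Phi> s) (at a)"
    and t: "t \<in> {0..\<tau>}"
  shows "((\<lambda>s. D\<Phi> s h) has_vector_derivative Df (\<Phi> a t) t (D\<Phi> t h)) (at t within {0..\<tau>})"
proof -
  have cont\<Phi>: "continuous_on {0..\<tau>} (\<Phi> b)" for b
    using has_vector_derivative_continuous[OF flow] by (auto simp: continuous_on_eq_continuous_within)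
  obtain R where R: "norm (\<Phi> a s) \<le> R" if "s \<in> {0..\<tau>}" for s
    using compact_imp_bounded[OF compact_continuous_image[OF cont\<Phi>[of a] compact_Icc]]
    unfolding bounded_iff by blast
  \<comment> \<open>The ball of radius \<open>R + 1\<close> contains the unit tube about the
    trajectory of \<open>a\<close>, on which \<open>gronwall_trajectories\<close> needs the
    Lipschitz bound.\<close>
  obtain L where L: "L \<ge> 0" and lip: "\<And>x y s. \<lbrakk>x \<in> cball 0 (R + 1); y \<in> cball 0 (R + 1); s \<in> {0..\<tau>}\<rbrakk> \<Longrightarrow>
      norm (f x s - f y s) \<le> L * norm (x - y)"
    using lipschitz_on_compact_tube[where R = "R + 1", OF f cont compact_Icc] by blast
  have lip': "norm (f y s - f (\<Phi> a s) s) \<le> L * norm (y - \<Phi> a s)"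
    if "s \<in> {0..\<tau>}" "norm (y - \<Phi> a s) \<le> 1" for y s
  proof (rule lip)
    show "\<Phi> a s \<in> cball 0 (R + 1)" using R[OF that(1)] by simp
    show "y \<in> cball 0 (R + 1)"
      using R[OF that(1)] that(2) norm_triangle_ineq[of "y - \<Phi> a s" "\<Phi> a s"] by simp
  qed (fact that)
  have "\<tau> \<ge> 0" using t by simp
  define N where "N = norm h * exp (L * \<tau>)"
  \<comment> \<open>Chosen so that \<open>\<epsilon> n * N < 1\<close>: the trajectory started at
    \<open>a + \<epsilon> n *\<^sub>R h\<close> then stays in the tube. Adding 1 to \<open>N\<close>
    covers \<open>h = 0\<close>.\<close>
  define \<epsilon> where "\<epsilon> n = 1 / ((N + 1) * (real n + 1))" for n
  have N: "N \<ge> 0" by (simp add: N_def)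
  have \<epsilon>: "\<epsilon> n > 0" "\<epsilon> n * N < 1" for n
  proof -
    show "\<epsilon> n > 0" using N by (simp add: \<epsilon>_def)
    have "N + 1 \<le> (N + 1) * (real n + 1)" using N by (simp add: algebra_simps)
    then have "N < (N + 1) * (real n + 1)" by linarith
    then show "\<epsilon> n * N < 1" using N by (simp add: \<epsilon>_def)
  qed
  have "\<epsilon> \<longlonglongrightarrow> 0" 
    unfolding \<epsilon>_def using N LIMSEQ_inverse_real_of_nat[THEN tendsto_mult_right_zero, of "inverse (N + 1)"]
    by (simp add: field_simps)
  define u where "u n = \<Phi> (a + \<epsilon> n *\<^sub>R h)" for n
  have u: "norm (u n s - \<Phi> a s) \<le> \<epsilon> n * N" if "s \<in> {0..\<tau>}" for n s
  proof -
    have 0: "norm (u n 0 - \<Phi> a 0) = \<epsilon> n * norm h" using \<epsilon>(1)[of n] by (simp add: u_def start)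
    have "norm (u n s - \<Phi> a s) \<le> norm (u n 0 - \<Phi> a 0) * exp (L * s)"
      by (rule gronwall_trajectories[where f = f and \<tau> = \<tau>])
        (use lip' flow that L \<epsilon>[of n] in \<open>auto simp: u_def start N_def algebra_simps\<close>)
    also have "\<dots> \<le> \<epsilon> n * norm h * exp (L * \<tau>)"
      unfolding 0 using \<epsilon>(1)[of n] L that by (intro mult_left_mono) (auto intro!: mult_left_mono)
    finally show ?thesis by (simp add: N_def algebra_simps)
  qed
  define q where "q n s = (u n s - \<Phi> a s) /\<^sub>R \<epsilon> n" for n s
  define q' where "q' n s = (f (u n s) s - f (\<Phi> a s) s) /\<^sub>R \<epsilon> n" for n s
  \<comment> \<open>Used twice: for the flow at a fixed time and for its composition with
    \<open>f\<close>.\<close>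
  have quotient: "(\<lambda>n. (g (a + \<epsilon> n *\<^sub>R h) - g a) /\<^sub>R \<epsilon> n) \<longlonglongrightarrow> Dg h"
    if "(g has_derivative Dg) (at a)" for g :: "'a \<Rightarrow> 'a" and Dg
  proof -
    interpret Dg: bounded_linear Dg using that by (rule has_derivative_bounded_linear)
    have "((\<lambda>r. a + r *\<^sub>R h) has_derivative (\<lambda>r. r *\<^sub>R h)) (at 0)"
      by (auto intro!: derivative_eq_intros)
    then have "((\<lambda>r. g (a + r *\<^sub>R h)) has_derivative (\<lambda>r. Dg (r *\<^sub>R h))) (at 0)"
      using has_derivative_compose[where g = g and g' = Dg] that by fastforce
    then have "((\<lambda>r. g (a + r *\<^sub>R h)) has_vector_derivative Dg h) (at 0)"
      by (simp add: has_vector_derivative_def Dg.scaleR)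
    then have "((\<lambda>r. norm (g (a + r *\<^sub>R h) - g a - r *\<^sub>R Dg h) / norm r) \<longlongrightarrow> 0) (at 0)"
      by (simp add: has_vector_derivative_def has_derivative_iff_norm)
    moreover have "filterlim \<epsilon> (at 0) sequentially"
      using \<open>\<epsilon> \<longlonglongrightarrow> 0\<close> \<epsilon>(1) by (auto simp: filterlim_at intro!: always_eventually less_imp_neq[THEN not_sym])
    ultimately have "(\<lambda>n. norm (g (a + \<epsilon> n *\<^sub>R h) - g a - \<epsilon> n *\<^sub>R Dg h) / norm (\<epsilon> n)) \<longlonglongrightarrow> 0"
      by (rule filterlim_compose)
    moreover have "norm (g (a + \<epsilon> n *\<^sub>R h) - g a - \<epsilon> n *\<^sub>R Dg h) / norm (\<epsilon> n)
        = norm ((g (a + \<epsilon> n *\<^sub>R h) - g a) /\<^sub>R \<epsilon> n - Dg h)" for n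
    proof -
      have "(g (a + \<epsilon> n *\<^sub>R h) - g a) /\<^sub>R \<epsilon> n - Dg h = (g (a + \<epsilon> n *\<^sub>R h) - g a - \<epsilon> n *\<^sub>R Dg h) /\<^sub>R \<epsilon> n"
        using \<epsilon>(1)[of n] by (simp add: scaleR_diff_right)
      then show ?thesis by (simp add: divide_inverse mult.commute)
    qed
    ultimately show ?thesis by (simp only: tendsto_norm_zero_iff LIM_zero_iff)
  qed
  have q_lim: "(\<lambda>n. q n s) \<longlonglongrightarrow> D\<Phi> s h" if "s \<in> {0..\<tau>}" for s
    using quotient[OF D\<Phi>[OF that]] by (simp add: q_def u_def)
  have q'_lim: "(\<lambda>n. q' n s) \<longlonglongrightarrow> Df (\<Phi> a s) s (D\<Phi> s h)" if "s \<in> {0..\<tau>}" for s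
    using quotient[OF has_derivative_compose[OF D\<Phi> f]] that by (simp add: q'_def u_def)
  \<comment> \<open>The Lipschitz and Gronwall bounds absorb the division by
    \<open>\<epsilon> n\<close>, leaving a constant that dominates all the quotients.\<close>
  have q'_bound: "norm (q' n s) \<le> L * N" if "s \<in> {0..\<tau>}" for n s
  proof -
    have "norm (f (u n s) s - f (\<Phi> a s) s) \<le> L * norm (u n s - \<Phi> a s)"
      using u[OF that, of n] \<epsilon>(2)[of n] by (intro lip' that) linarith
    also have "\<dots> \<le> L * (\<epsilon> n * N)" using u[OF that] L by (rule mult_left_mono)
    finally have "norm (f (u n s) s - f (\<Phi> a s) s) / \<epsilon> n \<le> L * N"
      using \<epsilon>(1)[of n] by (simp add: pos_divide_le_eq mult_ac)
    then show ?thesis using \<epsilon>(1)[of n] by (simp add: q'_def divide_inverse mult.commute)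
  qed
  have q_int: "(q' n has_integral (q n s - h)) {0..s}" if "s \<in> {0..\<tau>}" for n s
  proof -
    have "(q n has_vector_derivative q' n r) (at r within {0..s})" if "r \<in> {0..s}" for r
    proof -
      have "r \<in> {0..\<tau>}" "{0..s} \<subseteq> {0..\<tau>}" using that \<open>s \<in> {0..\<tau>}\<close> by auto
      then show ?thesis
        unfolding q_def q'_def u_def
        by (intro bounded_linear.has_vector_derivative[OF bounded_linear_scaleR_right]
            has_vector_derivative_diff has_vector_derivative_within_subset[OF flow])
    qed
    then have "(q' n has_integral (q n s - q n 0)) {0..s}"
      using that by (intro fundamental_theorem_of_calculus) auto
    moreover have "q n 0 = h" using \<epsilon>(1)[of n] by (simp add: q_def u_def start)
    ultimately show ?thesis by simp
  qed
  let ?G = "\<lambda>s. Df (\<Phi> a s) s (D\<Phi> s h)"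
  have int: "(?G has_integral (D\<Phi> s h - h)) {0..s}" if "s \<in> {0..\<tau>}" for s
  proof (rule has_integral_dominated_convergence[OF q_int[OF that] integrable_const_ivl])
    show "\<forall>r\<in>{0..s}. norm (q' n r) \<le> L * N" for n using q'_bound that by auto
    show "\<forall>r\<in>{0..s}. (\<lambda>n. q' n r) \<longlonglongrightarrow> ?G r" using q'_lim that by auto
    show "(\<lambda>n. q n s - h) \<longlonglongrightarrow> D\<Phi> s h - h" by (intro tendsto_intros q_lim that)
  qed
  \<comment> \<open>Bootstrap: the integral equation makes \<open>D\<Phi> s h\<close> continuous in
    \<open>s\<close>, hence also the integrand, and only then can the equation be
    differentiated.\<close>
  have eq: "D\<Phi> s h = h + integral {0..s} ?G" if "s \<in> {0..\<tau>}" for s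
    using integral_unique[OF int[OF that]] by simp
  have "continuous_on {0..\<tau>} (\<lambda>s. h + integral {0..s} ?G)"
    using int[of \<tau>] \<open>\<tau> \<ge> 0\<close>
    by (intro continuous_intros indefinite_integral_continuous_1) (auto simp: integrable_on_def)
  then have contD: "continuous_on {0..\<tau>} (\<lambda>s. D\<Phi> s h)"
    by (rule continuous_on_eq) (simp add: eq)
  \<comment> \<open>The basis expansion reduces to \<open>Df\<close> in fixed directions, where
    continuity is given.\<close>
  have "continuous_on {0..\<tau>} (\<lambda>s. \<Sum>b\<in>Basis. (D\<Phi> s h \<bullet> b) *\<^sub>R Df (\<Phi> a s) s b)"
  proof (intro continuous_intros contD)
    fix b :: 'a
    have "continuous_on {0..\<tau>} ((\<lambda>(x, s). Df x s b) \<circ> (\<lambda>s. (\<Phi> a s, s)))"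
      by (rule continuous_on_compose)
        (auto intro!: continuous_intros cont\<Phi> continuous_on_subset[OF cont])
    then show "continuous_on {0..\<tau>} (\<lambda>s. Df (\<Phi> a s) s b)" by (simp add: o_def)
  qed
  then have contG: "continuous_on {0..\<tau>} ?G"
  proof (rule continuous_on_eq)
    fix s assume s: "s \<in> {0..\<tau>}"
    interpret bounded_linear "Df (\<Phi> a s) s" using f[OF s] by (rule has_derivative_bounded_linear)
    show "(\<Sum>b\<in>Basis. (D\<Phi> s h \<bullet> b) *\<^sub>R Df (\<Phi> a s) s b) = ?G s"
      by (simp add: scaleR[symmetric] sum[symmetric] euclidean_representation)
  qed
  have "((\<lambda>s. h + integral {0..s} ?G) has_vector_derivative ?G t) (at t within {0..\<tau>})"
    using integral_has_vector_derivative[OF contG t]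
    by (auto intro!: derivative_eq_intros simp: has_vector_derivative_add_const)
  then show ?thesis
    by (rule has_vector_derivative_transform[OF t, rotated]) (simp add: eq)
qed

section \<open>The velocity gradient of an Euler flow\<close>

text \<open>Second derivatives appear as derivatives of \<open>F' z h\<close> for each fixed
  \<open>h\<close>, the shape that \<open>symmetric_second_derivative\<close> takes.\<close>

lemma smooth_field_derivatives:
  assumes "smooth_on S F"
  obtains F' F'' where
    "\<And>z. z \<in> S \<Longrightarrow> (F has_derivative F' z) (at z within S)"
    "\<And>z h. z \<in> S \<Longrightarrow> ((\<lambda>z. F' z h) has_derivative F'' h z) (at z within S)"
    "\<And>h. continuous_on S (\<lambda>z. F' z h)"
proof -
  have "Ck_on (Suc (Suc 0)) S F" using assms by (simp add: smooth_on_def)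
  then obtain F' where 1: "\<And>z. z \<in> S \<Longrightarrow> (F has_derivative F' z) (at z within S)"
    and "\<And>h. \<exists>f'. \<forall>z\<in>S. ((\<lambda>z. F' z h) has_derivative f' z) (at z within S)"
    unfolding Ck_on.simps by blast
  then obtain F'' where 2: "\<And>z h. z \<in> S \<Longrightarrow> ((\<lambda>z. F' z h) has_derivative F'' h z) (at z within S)"
    by metis
  then have "continuous_on S (\<lambda>z. F' z h)" for h
    by (auto simp: continuous_on_eq_continuous_within intro!: has_derivative_continuous)
  with 1 2 show ?thesis by (rule that)
qed

lemma smooth_on_imp_differentiable:
  assumes "smooth_on UNIV f"
  shows "f differentiable (at x)"
  using smooth_field_derivatives[OF assms] by (metis UNIV_I differentiableI)

text \<open>The slice at time \<open>t\<close> lies in the space-time domain, so the spatial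
  derivative is a full one even at the initial time.\<close>

lemma spatial_derivative:
  assumes "((\<lambda>(x, t). v x t) has_derivative D) (at (x, t) within UNIV \<times> I)" and "t \<in> I"
  shows "((\<lambda>y. v y t) has_derivative (\<lambda>h. D (h, 0))) (at x)"
proof -
  have "((\<lambda>y. (y, t)) has_derivative (\<lambda>h. (h, 0))) (at x)"
    by (auto intro!: derivative_eq_intros)
  moreover have "((\<lambda>(x, t). v x t) has_derivative D) (at (x, t) within (range (\<lambda>y. (y, t))))"
    by (rule has_derivative_subset[OF assms(1)]) (use assms(2) in auto)
  ultimately have "((\<lambda>y. (case (y, t) of (x, t) \<Rightarrow> v x t)) has_derivative (\<lambda>h. D (h, 0))) (at x)"
    by (rule has_derivative_in_compose)
  then show ?thesis by simp
qed

lemma jacobian_spatial: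
  fixes v :: "real^'n \<Rightarrow> real \<Rightarrow> real^'m"
  assumes "((\<lambda>(x, t). v x t) has_derivative D) (at (x, t) within UNIV \<times> I)" and "t \<in> I"
  shows "jacobian (\<lambda>y. v y t) (at x) *v h = D (h, 0)"
    and "jacobian (\<lambda>y. v y t) (at x) $ i $ j = D (axis j 1, 0) $ i"
proof -
  note D = spatial_derivative[OF assms]
  then have "((\<lambda>y. v y t) has_derivative (\<lambda>h. jacobian (\<lambda>y. v y t) (at x) *v h)) (at x)"
    using jacobian_works differentiableI by blast
  from has_derivative_unique[OF this D] show *: "jacobian (\<lambda>y. v y t) (at x) *v h = D (h, 0)" for h
    by metis
  show "jacobian (\<lambda>y. v y t) (at x) $ i $ j = D (axis j 1, 0) $ i"
    unfolding *[symmetric] by (simp add: matrix_vector_mult_basis column_def)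
qed

text \<open>The momentum equation says that \<open>B + G\<^sup>2\<close> is minus the Hessian of the pressure.\<close>

lemma euler_gradient_along_trajectory:
  assumes euler: "smooth_euler_solution T v0 v p"
    and t: "0 < t" "ereal t < T"
    and z: "(z has_vector_derivative v (z t) t) (at t)"
  defines "G \<equiv> \<lambda>s. jacobian (\<lambda>y. v y s) (at (z s))"
  obtains B where "(G has_vector_derivative B) (at t)" "transpose (B + G t ** G t) = B + G t ** G t"
proof -
  define S where "S = (UNIV :: (real^3) set) \<times> time_interval T"
  define F where "F = (\<lambda>(x, t). v x t)"
  have "smooth_on S F" using euler by (simp add: smooth_euler_solution_def S_def F_def)
  then obtain F' F'' where F': "\<And>z. z \<in> S \<Longrightarrow> (F has_derivative F' z) (at z within S)"
    and F'': "\<And>z h. z \<in> S \<Longrightarrow> ((\<lambda>z. F' z h) has_derivative F'' h z) (at z within S)"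
    using smooth_field_derivatives by metis
  have jac: "jacobian (\<lambda>y. v y s) (at y) *v h = F' (y, s) (h, 0)"
    and entry: "jacobian (\<lambda>y. v y s) (at y) $ i $ j = F' (y, s) (axis j 1, 0) $ i"
    if "s \<in> time_interval T" for y s h i j
    using F'[of "(y, s)"] that unfolding S_def F_def by (intro jacobian_spatial; auto)+
  \<comment> \<open>At positive times derivatives within \<open>S\<close> are ordinary derivatives
    on an open set, as the symmetry of second derivatives requires.\<close>
  define I where "I = {t. 0 < t \<and> ereal t < T}"
  define U where "U = (UNIV :: (real^3) set) \<times> I"
  have "open I"
    unfolding I_def by (intro open_Collect_conj open_Collect_less continuous_intros) 
  then have "open U" unfolding U_def by (intro open_Times) auto
  have I: "I \<subseteq> time_interval T" by (auto simp: I_def time_interval_def)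
  then have "U \<subseteq> S" by (auto simp: U_def S_def)
  then have at: "at z within S = at z" if "z \<in> U" for z
    using that \<open>open U\<close> by (meson at_within_open_subset)
  have F'U: "(F has_derivative F' z) (at z)" if "z \<in> U" for z
    using F'[of z] at[OF that] that \<open>U \<subseteq> S\<close> by auto
  have F''U: "((\<lambda>z. F' z h) has_derivative F'' h z) (at z)" if "z \<in> U" for z h
    using F''[of z h] at[OF that] that \<open>U \<subseteq> S\<close> by auto
  have lin: "bounded_linear (F' z)" "bounded_linear (F'' h z)" if "z \<in> U" for z h
    by (rule has_derivative_bounded_linear[OF F'U[OF that]], rule has_derivative_bounded_linear[OF F''U[OF that]])
  have sym: "F'' h z k = F'' k z h" if "z \<in> U" for h k z
    unfolding vec_eq_iff
  proof
    fix i
    show "F'' h z k $ i = F'' k z h $ i"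
      by (rule symmetric_second_derivative[where f = "\<lambda>z. F z $ i" and f' = "\<lambda>z h. F' z h $ i", OF \<open>open U\<close> that])
        (auto intro!: bounded_linear.has_derivative[OF bounded_linear_vec_nth] F'U F''U that)
  qed
  have U: "(y, t) \<in> U" for y using t by (simp add: U_def I_def)
  have tI: "t \<in> I" and tT: "t \<in> time_interval T" using t by (auto simp: I_def time_interval_def)
  define x where "x = z t"
  define w where "w = v x t"
  \<comment> \<open>The material derivative of the velocity gradient: \<open>(w, 1)\<close> is the
    tangent of the space-time curve \<open>(z s, s)\<close> at \<open>t\<close>.\<close>
  define B :: "real^3^3" where "B = matrix (\<lambda>h. F'' (h, 0) (x, t) (w, 1))"
  have "(G has_vector_derivative B) (at t)"
  proof (intro has_vector_derivative_vec_componentwise)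
    fix i j
    have "((\<lambda>s. (z s, s)) has_vector_derivative (w, 1)) (at t)"
      using z by (auto intro!: derivative_eq_intros simp: x_def w_def)
    then have "((\<lambda>s. (z s, s)) has_derivative (\<lambda>r. r *\<^sub>R (w, 1))) (at t)"
      by (simp only: has_vector_derivative_def)
    moreover have "((\<lambda>z. F' z (axis j 1, 0)) has_derivative F'' (axis j 1, 0) (z t, t)) (at (z t, t))"
      by (rule F''U[OF U])
    ultimately have "((\<lambda>s. F' (z s, s) (axis j 1, 0)) has_derivative (\<lambda>r. F'' (axis j 1, 0) (x, t) (r *\<^sub>R (w, 1)))) (at t)"
      unfolding x_def by (rule has_derivative_compose)
    then have "((\<lambda>s. F' (z s, s) (axis j 1, 0)) has_vector_derivative F'' (axis j 1, 0) (x, t) (w, 1)) (at t)"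
      unfolding has_vector_derivative_def linear_scale[OF bounded_linear.linear[OF lin(2)[OF U]]] .
    from bounded_linear.has_vector_derivative[OF bounded_linear_vec_nth this, of i]
    have "((\<lambda>s. F' (z s, s) (axis j 1, 0) $ i) has_vector_derivative B $ i $ j) (at t)"
      by (simp add: B_def matrix_def)
    then show "((\<lambda>s. G s $ i $ j) has_vector_derivative B $ i $ j) (at t)"
    proof (rule has_vector_derivative_transform_within_open[OF _ \<open>open I\<close> tI])
      fix s assume "s \<in> I"
      then show "F' (z s, s) (axis j 1, 0) $ i = G s $ i $ j"
        using I by (auto simp: G_def entry)
    qed
  qed
  moreover have "transpose (B + G t ** G t) = B + G t ** G t"
  proof -
    \<comment> \<open>Linearity of \<open>F''\<close> is immediate only in its last argument;
      \<open>sym\<close> carries it over to the other direction.\<close>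
    have lin_B: "linear (\<lambda>h. F'' (h, 0) (x, t) (w, 1))"
    proof (rule linearI)
      interpret bounded_linear "F'' (w, 1) (x, t)" by (rule lin(2)[OF U])
      show "F'' (a + b, 0) (x, t) (w, 1) = F'' (a, 0) (x, t) (w, 1) + F'' (b, 0) (x, t) (w, 1)" for a b
        using add[of "(a, 0)" "(b, 0)"] by (simp add: sym[OF U, where k = "(w, 1)"])
      show "F'' (r *\<^sub>R a, 0) (x, t) (w, 1) = r *\<^sub>R F'' (a, 0) (x, t) (w, 1)" for r a
        using scaleR[of r "(a, 0)"] by (simp add: sym[OF U, where k = "(w, 1)"])
    qed
    have BG: "(B + G t ** G t) *v k = F'' (k, 0) (x, t) (w, 1) + F' (x, t) (F' (x, t) (k, 0), 0)" for k
    proof -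
      have "G t *v k = F' (x, t) (k, 0)" for k by (simp add: jac[OF tT] G_def x_def)
      moreover have "B *v k = F'' (k, 0) (x, t) (w, 1)"
        unfolding B_def by (rule fun_cong[OF matrix_vector_mul(2)[OF lin_B]])
      ultimately show ?thesis
        by (simp add: matrix_vector_mult_add_rdistrib matrix_vector_mul_assoc[symmetric])
    qed
    define q where "q y = frechet_derivative (\<lambda>y. p y t) (at y)" for y
    have q: "((\<lambda>y. p y t) has_derivative q y) (at y)" for y
      using euler tT frechet_derivative_works unfolding smooth_euler_solution_def q_def by blast
    \<comment> \<open>The momentum equation expresses the pressure gradient through \<open>v\<close>
      and its first derivatives, which makes it differentiable although only a gradient of
      \<open>p\<close> is postulated.\<close>
    have q_eq: "q y (axis j 1) = - (F' (y, t) (0, 1) + F' (y, t) (v y t, 0)) $ j" for y j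
    proof -
      obtain vt where vt: "((\<lambda>s. v y s) has_vector_derivative vt) (at t within time_interval T)"
        and mom: "vt + jacobian (\<lambda>y. v y t) (at y) *v v y t = - gradient (\<lambda>y. p y t) y"
        using euler tT unfolding smooth_euler_solution_def by blast
      have "at t within time_interval T = at t"
        using \<open>open I\<close> tI I by (meson at_within_open_subset)
      with vt have vt: "((\<lambda>s. v y s) has_vector_derivative vt) (at t)" by simp
      have "((\<lambda>s. (y, s)) has_derivative (\<lambda>r. (0, r))) (at t)"
        by (auto intro!: derivative_eq_intros)
      from has_derivative_compose[OF this F'U[OF U]]
      have "((\<lambda>s. v y s) has_derivative (\<lambda>r. F' (y, t) (0, r))) (at t)"
        by (simp add: F_def)
      then have "vt = F' (y, t) (0, 1)"
        using vt unfolding has_vector_derivative_def by (metis has_derivative_unique scaleR_one)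
      moreover have "gradient (\<lambda>y. p y t) y $ j = q y (axis j 1)" by (simp add: gradient_def q_def)
      ultimately show ?thesis using mom jac[OF tT, of y "v y t"]
        by (metis minus_minus vector_uminus_component)
    qed
    have line: "((\<lambda>y. (y, t)) has_derivative (\<lambda>h. (h, 0))) (at x)"
      by (auto intro!: derivative_eq_intros)
    have F'x: "((\<lambda>y. F' (y, t) h) has_derivative (\<lambda>k. F'' h (x, t) (k, 0))) (at x)" for h
      by (rule has_derivative_compose[OF line F''U[OF U]])
    \<comment> \<open>Separates the varying direction \<open>v y t\<close> from the derivative, so
      that the product rule applies with the fixed directions \<open>axis l 1\<close>.\<close>
    have expand: "F' (y, t) (a, 0) = (\<Sum>l\<in>UNIV. a $ l *\<^sub>R F' (y, t) (axis l 1, 0))" for y a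
      using jac[OF tT] by (metis (no_types, lifting) matrix_mult_sum matrix_vector_mult_basis scalar_mult_eq_scaleR sum.cong)
    \<comment> \<open>The two terms are \<open>G^2 k\<close> and the convective part of
      \<open>B k\<close>; the remaining part of \<open>B k\<close> comes from the time derivative of
      \<open>v\<close>.\<close>
    have "((\<lambda>y. F' (y, t) (v y t, 0)) has_derivative
        (\<lambda>k. F' (x, t) (F' (x, t) (k, 0), 0) + F'' (k, 0) (x, t) (w, 0))) (at x)"
    proof -
      have vx: "((\<lambda>y. v y t $ l) has_derivative (\<lambda>k. F' (x, t) (k, 0) $ l)) (at x)" for l
        using F'[of "(x, t)"] tT unfolding S_def F_def
        by (intro bounded_linear.has_derivative[OF bounded_linear_vec_nth] spatial_derivative) auto
      have "(\<Sum>l\<in>UNIV. w $ l *\<^sub>R F'' (axis l 1, 0) (x, t) (k, 0)) = F'' (k, 0) (x, t) (w, 0)" for k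
      proof -
        interpret bounded_linear "F'' (k, 0) (x, t)" by (rule lin(2)[OF U])
        have "(w, 0) = (\<Sum>l\<in>UNIV. w $ l *\<^sub>R (axis l 1, 0::real))"
          by (simp add: prod_eq_iff fst_sum snd_sum basis_expansion scalar_mult_eq_scaleR[symmetric])
        then show ?thesis by (simp only: sum scaleR sym[OF U, where k = "(k, 0)"])
      qed
      then show ?thesis
        unfolding expand[of _ "v _ t"]
        by (intro has_derivative_eq_rhs[OF has_derivative_sum[OF has_derivative_scaleR[OF vx F'x]]])
          (simp add: expand[of x "F' (x, t) (_, 0)"] sum.distrib w_def fun_eq_iff add.commute)
    qed
    then have "((\<lambda>y. - (F' (y, t) (0, 1) + F' (y, t) (v y t, 0)) $ j) has_derivative
        (\<lambda>k. - ((B + G t ** G t) *v k) $ j)) (at x)" for j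
    proof -
      interpret F''k: bounded_linear "F'' (k, 0) (x, t)" for k by (rule lin(2)[OF U])
      have "F'' (k, 0) (x, t) (w, 1) = F'' (k, 0) (x, t) (0, 1) + F'' (k, 0) (x, t) (w, 0)" for k
        using F''k.add[of k "(0, 1)" "(w, 0)"] by simp
      then have BG': "(B + G t ** G t) *v k = F'' (0, 1) (x, t) (k, 0)
          + (F' (x, t) (F' (x, t) (k, 0), 0) + F'' (k, 0) (x, t) (w, 0))" for k
        by (simp add: BG sym[OF U, where k = "(0, 1)"])
      show ?thesis
        unfolding BG'
        by (intro has_derivative_minus bounded_linear.has_derivative[OF bounded_linear_vec_nth] has_derivative_add F'x)
          fact
    qed
    then have "((\<lambda>y. q y (axis j 1)) has_derivative (\<lambda>k. - ((B + G t ** G t) *v k) $ j)) (at x)" for j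
      by (simp only: q_eq)
    from symmetric_second_derivative[OF open_UNIV UNIV_I q this this]
    have "(B + G t ** G t) $ j $ i = (B + G t ** G t) $ i $ j" for i j
      unfolding neg_equal_iff_equal matrix_vector_mult_basis column_def vec_lambda_beta by metis
    then show ?thesis by (simp add: vec_eq_iff transpose_def)
  qed
  ultimately show ?thesis by (rule that)
qed

section \<open>Cauchy's formula and the eigenvalues of the label metric\<close>

text \<open>The form \<open>w \<bullet> (M w)\<close> with \<open>M = K^T K\<close> is
  \<open>|K w|^2\<close> and is diagonal in the eigenbasis; the determinant follows from the
  diagonalization \<open>M E^T = E^T D\<close>.\<close>

lemma ordered_eigensystem_expansion:
  assumes eig: "ordered_eigensystem (transpose K ** K) lam e"
  shows "(\<Sum>j\<in>UNIV. lam j * (w \<bullet> e j)\<^sup>2) = (norm (K *v w))\<^sup>2"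
    and "(\<Sum>j\<in>UNIV. (w \<bullet> e j)\<^sup>2) = (norm w)\<^sup>2"
    and "lam 1 * lam 2 * lam 3 = (det K)\<^sup>2"
proof -
  define M where "M = transpose K ** K"
  define E :: "real^3^3" where "E = (\<chi> i. e i)"
  define D :: "real^3^3" where "D = (\<chi> i j. if i = j then lam i else 0)"
  have M: "M *v e j = lam j *\<^sub>R e j" and orth: "e i \<bullet> e j = (if i = j then 1 else 0)" for i j
    using eig by (auto simp: ordered_eigensystem_def M_def)
  have EE: "E ** transpose E = mat 1"
    by (simp add: E_def matrix_mult_transpose_dot_row row_def orth mat_def vec_eq_iff)
  \<comment> \<open>A right inverse of a square matrix is a left inverse, so orthonormality already
    gives completeness.\<close>
  then have "transpose E *v (E *v w) = w"
    by (metis matrix_left_right_inverse matrix_vector_mul_assoc matrix_vector_mul_lid)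
  then have w: "w = (\<Sum>j\<in>UNIV. (w \<bullet> e j) *\<^sub>R e j)"
    by (simp add: vec_eq_iff E_def matrix_vector_mult_def transpose_def inner_vec_def mult_ac)
  have "w \<bullet> w = w \<bullet> (\<Sum>j\<in>UNIV. (w \<bullet> e j) *\<^sub>R e j)" using w by simp
  then show "(\<Sum>j\<in>UNIV. (w \<bullet> e j)\<^sup>2) = (norm w)\<^sup>2"
    by (simp add: inner_sum_right power2_eq_square[of "_ \<bullet> _"] power2_norm_eq_inner)
  have "M *v w = M *v (\<Sum>j\<in>UNIV. (w \<bullet> e j) *\<^sub>R e j)" using w by simp
  also have "\<dots> = (\<Sum>j\<in>UNIV. (w \<bullet> e j) *\<^sub>R lam j *\<^sub>R e j)"
    by (simp add: linear_sum[OF matrix_vector_mul_linear] matrix_vector_mult_scaleR M)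
  finally have "w \<bullet> (M *v w) = (\<Sum>j\<in>UNIV. lam j * (w \<bullet> e j)\<^sup>2)"
    by (simp add: inner_sum_right power2_eq_square mult_ac)
  moreover have "w \<bullet> (M *v w) = (norm (K *v w))\<^sup>2"
    by (metis M_def inner_commute inner_transpose_matrix_vector matrix_vector_mul_assoc power2_norm_eq_inner)
  ultimately show "(\<Sum>j\<in>UNIV. lam j * (w \<bullet> e j)\<^sup>2) = (norm (K *v w))\<^sup>2" by simp
  have "(M ** transpose E) $ i $ j = (transpose E ** D) $ i $ j" for i j
  proof -
    have "(M ** transpose E) $ i $ j = (M *v e j) $ i"
      by (simp add: matrix_matrix_mult_def matrix_vector_mult_def transpose_def E_def)
    also have "\<dots> = (transpose E ** D) $ i $ j"
      by (simp add: M matrix_matrix_mult_def transpose_def E_def D_def if_distrib mult.commute cong: if_cong)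
    finally show ?thesis .
  qed
  then have "M ** transpose E = transpose E ** D" by (simp add: vec_eq_iff)
  then have "det M * det E = det E * det D" by (metis det_mul det_transpose)
  moreover have "det E \<noteq> 0" using EE by (metis det_I det_mul mult_zero_left zero_neq_one)
  ultimately have "det M = det D" by simp
  moreover have "det D = lam 1 * lam 2 * lam 3" by (simp add: det_3 D_def)
  ultimately show "lam 1 * lam 2 * lam 3 = (det K)\<^sup>2"
    by (simp add: M_def det_mul power2_eq_square)
qed

text \<open>The set where the continuous function \<open>norm (u x)\<close> exceeds an essential
  bound is open and null, hence empty. \<open>C \<ge> 1\<close> allows division by \<open>C\<close>
  later.\<close>

lemma Linf_norm_bound:
  assumes cont: "continuous_on UNIV u" and fin: "Linf_norm u < \<infinity>"
  obtains C where "C \<ge> 1" "\<And>x. norm (u x) \<le> C"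
proof -
  obtain C where C: "C \<ge> 1" "Linf_norm u \<le> ereal C"
  proof (cases "Linf_norm u")
    case (real r)
    then show ?thesis by (intro that[of "max 1 r"]) auto
  qed (use fin that[of 1] in auto)
  have "AE x in lebesgue. ereal (norm (u x)) \<le> Linf_norm u"
    unfolding Linf_norm_def by (rule esssup_AE)
  then have AE: "AE x in lebesgue. norm (u x) \<le> C"
    by eventually_elim (use C(2) ereal_less_eq(3) order_trans in blast)
  define S where "S = {x. C < norm (u x)}"
  have "open S" unfolding S_def by (intro open_Collect_less continuous_intros cont)
  have "S \<in> null_sets lebesgue"
  proof -
    have "{x \<in> space lebesgue. \<not> norm (u x) \<le> C} \<in> null_sets lebesgue"
      using AE \<open>open S\<close> by (subst AE_iff_null[symmetric]) (auto simp: S_def not_le borel_open)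
    then show ?thesis by (simp add: S_def not_le)
  qed
  then have "negligible S" by (simp add: negligible_iff_null_sets)
  then have "S = {}" using open_not_negligible[OF \<open>open S\<close>] by blast
  then show ?thesis using that[OF C(1)] by (auto simp: S_def not_less)
qed

text \<open>Both invariants are constant along the trajectory that arrives at \<open>x\<close> at
  time \<open>t\<close>. At time 0 the flow differential is the identity, so they reduce to the
  standard volume form and to \<open>curl v0\<close>.\<close>

lemma cauchy_vorticity_formula:
  fixes X :: "real^3 \<Rightarrow> real \<Rightarrow> real^3" and x :: "real^3"
  assumes euler: "smooth_euler_solution T v0 v p"
    and traj: "trajectory_map T v X"
    and diffeo: "\<And>s. s \<in> time_interval T \<Longrightarrow> diffeo (\<lambda>a. X a s)"
    and t: "t \<in> time_interval T"
  defines "K \<equiv> jacobian (\<lambda>y. back_to_label X y t) (at x)"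
  shows "K *v vorticity v x t = curl v0 (back_to_label X x t)" "det K = 1"
proof -
  define S where "S = (UNIV :: (real^3) set) \<times> time_interval T"
  have "smooth_on S (\<lambda>(x, t). v x t)" using euler by (simp add: smooth_euler_solution_def S_def)
  then obtain F' where F': "\<And>z. z \<in> S \<Longrightarrow> ((\<lambda>(x, t). v x t) has_derivative F' z) (at z within S)"
    and contF': "\<And>h. continuous_on S (\<lambda>z. F' z h)"
    using smooth_field_derivatives by metis
  have sub: "{0..t} \<subseteq> time_interval T"
    using t by (auto simp: time_interval_def) (meson ereal_less_eq(3) le_less_trans)
  have "t \<ge> 0" using t by (simp add: time_interval_def)
  define a where "a = back_to_label X x t"
  define J where "J s = jacobian (\<lambda>a. X a s) (at a)" for s
  define G where "G s = jacobian (\<lambda>y. v y s) (at (X a s))" for s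
  have FS: "((\<lambda>(x, t). v x t) has_derivative F' (y, s)) (at (y, s) within UNIV \<times> time_interval T)"
    if "s \<in> time_interval T" for y s
    using F'[of "(y, s)"] that by (simp add: S_def)
  have GF: "G s *v h = F' (X a s, s) (h, 0)" if "s \<in> time_interval T" for s h
    unfolding G_def by (rule jacobian_spatial(1)[OF FS[OF that] that])
  have start: "X b 0 = b" for b using traj by (simp add: trajectory_map_def)
  have flow: "(X b has_vector_derivative v (X b s) s) (at s within {0..t})" if "s \<in> {0..t}" for b s
    using traj sub that unfolding trajectory_map_def
    by (intro has_vector_derivative_within_subset[where S = "time_interval T" and T = "{0..t}"]) auto
  have DX: "((\<lambda>b. X b s) has_derivative (\<lambda>h. J s *v h)) (at a)" if "s \<in> time_interval T" for s
    using diffeo[OF that] unfolding diffeo_def J_def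
    by (simp add: jacobian_works[symmetric] smooth_on_imp_differentiable)
  have dJ: "((\<lambda>s. J s *v h) has_vector_derivative G s *v (J s *v h)) (at s within {0..t})"
    if s: "s \<in> {0..t}" for s h
  proof -
    have "((\<lambda>s. J s *v h) has_vector_derivative F' (X a s, s) (J s *v h, 0)) (at s within {0..t})"
    proof (rule flow_variation[where f = v and \<Phi> = X and Df = "\<lambda>x s h. F' (x, s) (h, 0)"])
      show "((\<lambda>y. v y s) has_derivative (\<lambda>h. F' (y, s) (h, 0))) (at y)" if "s \<in> {0..t}" for y s
        using sub that by (intro spatial_derivative[OF FS]) auto
      show "continuous_on (UNIV \<times> {0..t}) (\<lambda>(x, s). F' (x, s) (h, 0))" for h
        using continuous_on_subset[OF contF', of "UNIV \<times> {0..t}" "(h, 0)"] sub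
        by (auto simp: S_def case_prod_unfold)
    qed (use start flow DX sub s in auto)
    then show ?thesis using GF sub s by auto
  qed
  have contJ: "continuous_on {0..t} (\<lambda>s. J s *v h)" for h
    using has_vector_derivative_continuous[OF dJ] by (auto simp: continuous_on_eq_continuous_within)
  have contX: "continuous_on {0..t} (X a)"
    using has_vector_derivative_continuous[OF flow] by (auto simp: continuous_on_eq_continuous_within)
  have "continuous_on {0..t} (\<lambda>s. \<chi> i j. F' (X a s, s) (axis j 1, 0) $ i)"
  proof (intro continuous_on_vec_lambda continuous_on_component)
    fix j :: 3
    have "continuous_on {0..t} ((\<lambda>z. F' z (axis j 1, 0)) \<circ> (\<lambda>s. (X a s, s)))"
      using sub by (intro continuous_on_compose continuous_intros contX continuous_on_subset[OF contF']) (auto simp: S_def)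
    then show "continuous_on {0..t} (\<lambda>s. F' (X a s, s) (axis j 1, 0))" by (simp add: o_def)
  qed
  then have contG: "continuous_on {0..t} G"
  proof (rule continuous_on_eq)
    fix s assume "s \<in> {0..t}"
    then show "(\<chi> i j. F' (X a s, s) (axis j 1, 0) $ i) = G s"
      unfolding G_def using sub by (auto simp: vec_eq_iff jacobian_spatial(2)[OF FS])
  qed
  have dJ': "((\<lambda>s. J s *v h) has_vector_derivative G s *v (J s *v h)) (at s)" if "0 < s" "s < t" for s h
    using dJ[of s h] at_within_interior[of s "{0..t}"] that by simp
  \<comment> \<open>Only interior derivatives enter, because the symmetry of \<open>B + G^2\<close>
    is available at positive times; continuity adds the endpoints.\<close>
  have const: "g t = g 0"
    if "continuous_on {0..t} g" "\<And>s. 0 < s \<Longrightarrow> s < t \<Longrightarrow> (g has_vector_derivative 0) (at s)" for g :: "real \<Rightarrow> real"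
    using DERIV_isconst_end[of 0 t g] that \<open>t \<ge> 0\<close>
    by (cases "t = 0") (auto simp: has_real_derivative_iff_has_vector_derivative)
  have J0: "J 0 *v h = h" for h
  proof -
    have "((\<lambda>b. X b 0) has_derivative (\<lambda>h. J 0 *v h)) (at a)" using DX sub \<open>t \<ge> 0\<close> by auto
    moreover have "((\<lambda>b. X b 0) has_derivative (\<lambda>h. h)) (at a)" by (simp add: start)
    ultimately show ?thesis by (metis has_derivative_unique)
  qed
  have bij: "bij (\<lambda>b. X b t)" using diffeo[OF t] by (simp add: diffeo_def)
  then have inv: "X (back_to_label X y t) t = y" for y
    unfolding back_to_label_def by (simp add: bij_is_surj surj_f_inv_f[where f = "\<lambda>b. X b t"])
  have volume: "(J t *v h) \<bullet> cross3 (J t *v k) (J t *v l) = h \<bullet> cross3 k l" for h k l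
  proof -
    have "(J t *v h) \<bullet> cross3 (J t *v k) (J t *v l) = (J 0 *v h) \<bullet> cross3 (J 0 *v k) (J 0 *v l)"
    proof (rule const)
      show "continuous_on {0..t} (\<lambda>s. (J s *v h) \<bullet> cross3 (J s *v k) (J s *v l))"
        by (intro continuous_on_inner continuous_on_cross contJ)
      fix s assume s: "0 < s" "s < t"
      have "s \<in> time_interval T" using sub s by auto
      then have "trace (G s) = 0"
        using euler unfolding smooth_euler_solution_def divergence_def G_def by auto
      then show "((\<lambda>s. (J s *v h) \<bullet> cross3 (J s *v k) (J s *v l)) has_vector_derivative 0) (at s)"
        using triple_product_derivative[OF dJ'[OF s, of h] dJ'[OF s, of k] dJ'[OF s, of l]] by simp
    qed
    then show ?thesis by (simp add: J0)
  qed
  have form: "(J t *v h) \<bullet> cross3 (vorticity v x t) (J t *v k) = h \<bullet> cross3 (curl v0 a) k" for h k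
  proof -
    \<comment> \<open>By \<open>jacobian_antisymmetric_part\<close> this is the vorticity triple
      product, in the form that \<open>cauchy_invariant_derivative\<close> differentiates.\<close>
    let ?\<psi> = "\<lambda>s. (J s *v h) \<bullet> (G s *v (J s *v k)) - (J s *v k) \<bullet> (G s *v (J s *v h))"
    have "?\<psi> t = ?\<psi> 0"
    proof (rule const)
      show "continuous_on {0..t} ?\<psi>"
        by (intro continuous_intros contJ bounded_bilinear.continuous_on[OF bounded_bilinear_matrix_vector_mult contG])
      fix s assume s: "0 < s" "s < t"
      have "s \<in> time_interval T" using sub s by auto
      then have "ereal s < T" by (simp add: time_interval_def)
      moreover have "(X a has_vector_derivative v (X a s) s) (at s)"
        using flow[of s a] at_within_interior[of s "{0..t}"] s by simp
      ultimately obtain B where "(G has_vector_derivative B) (at s)" "transpose (B + G s ** G s) = B + G s ** G s"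
        using euler_gradient_along_trajectory[OF euler s(1)] unfolding G_def by blast
      then show "(?\<psi> has_vector_derivative 0) (at s)"
        by (intro cauchy_invariant_derivative dJ' s)
    qed
    moreover have "(\<lambda>y. v y 0) = v0" using euler by (auto simp: smooth_euler_solution_def)
    ultimately show ?thesis
      by (simp add: J0 G_def jacobian_antisymmetric_part start a_def inv vorticity_def)
  qed
  \<comment> \<open>Chain rule applied to \<open>inv\<close>.\<close>
  have "J t ** K = mat 1"
  proof -
    have "(\<lambda>y. back_to_label X y t) differentiable (at x)"
      using diffeo[OF t] unfolding diffeo_def back_to_label_def by (auto intro: smooth_on_imp_differentiable)
    then have "((\<lambda>y. back_to_label X y t) has_derivative (\<lambda>h. K *v h)) (at x)"
      by (simp add: jacobian_works K_def)
    from has_derivative_compose[OF this] DX[OF t]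
    have "((\<lambda>y. X (back_to_label X y t) t) has_derivative (\<lambda>h. J t *v (K *v h))) (at x)"
      by (simp add: a_def)
    then have "(\<lambda>h. J t *v (K *v h)) = (\<lambda>h. h)"
      unfolding inv using has_derivative_ident has_derivative_unique by blast
    then show ?thesis by (metis matrix_eq matrix_vector_mul_assoc matrix_vector_mul_lid)
  qed
  from pullback_by_unimodular[OF volume form this]
  show "K *v vorticity v x t = curl v0 (back_to_label X x t)" "det K = 1" by (simp_all add: a_def)
qed

text \<open>Continuity upgrades the essential bound on the initial vorticity to a pointwise one.
  \<open>0 < T\<close> puts time 0 into the domain, where \<open>v0\<close> is a slice of the smooth
  field.\<close>

lemma initial_vorticity_continuous:
  assumes euler: "smooth_euler_solution T v0 v p" and "0 < T"
  shows "continuous_on UNIV (curl v0)"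
proof -
  have "smooth_on (UNIV \<times> time_interval T) (\<lambda>(x, t). v x t)"
    using euler by (simp add: smooth_euler_solution_def)
  then obtain F' where F': "\<And>z. z \<in> UNIV \<times> time_interval T \<Longrightarrow>
      ((\<lambda>(x, t). v x t) has_derivative F' z) (at z within UNIV \<times> time_interval T)"
    and contF': "\<And>h. continuous_on (UNIV \<times> time_interval T) (\<lambda>z. F' z h)"
    using smooth_field_derivatives by metis
  have 0: "0 \<in> time_interval T" using \<open>0 < T\<close> by (simp add: time_interval_def zero_ereal_def)
  have v0: "v0 = (\<lambda>y. v y 0)" using euler by (auto simp: smooth_euler_solution_def)
  have J: "jacobian v0 (at x) $ i $ j = F' (x, 0) (axis j 1, 0) $ i" for x i j
    unfolding v0 using 0 by (intro jacobian_spatial(2)[OF F']) auto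
  have "continuous_on UNIV ((\<lambda>z. F' z (axis j 1, 0)) \<circ> (\<lambda>x. (x, 0)))" for j
    using 0 by (intro continuous_on_compose continuous_intros continuous_on_subset[OF contF']) auto
  then have cont: "continuous_on UNIV (\<lambda>x. jacobian v0 (at x) $ i $ j)" for i j
    unfolding J by (intro continuous_on_component) (simp add: o_def)
  have "curl v0 = (\<lambda>x. \<chi> i. if i = 1 then jacobian v0 (at x) $ 3 $ 2 - jacobian v0 (at x) $ 2 $ 3
      else if i = 2 then jacobian v0 (at x) $ 1 $ 3 - jacobian v0 (at x) $ 3 $ 1
      else jacobian v0 (at x) $ 2 $ 1 - jacobian v0 (at x) $ 1 $ 2)"
    by (simp add: fun_eq_iff vec_eq_iff forall_3 curl_def Let_def)
  moreover have "continuous_on UNIV \<dots>"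
  proof (rule continuous_on_vec_lambda)
    fix i :: 3
    show "continuous_on UNIV (\<lambda>x. if i = 1 then jacobian v0 (at x) $ 3 $ 2 - jacobian v0 (at x) $ 2 $ 3
      else if i = 2 then jacobian v0 (at x) $ 1 $ 3 - jacobian v0 (at x) $ 3 $ 1
      else jacobian v0 (at x) $ 2 $ 1 - jacobian v0 (at x) $ 1 $ 2)"
      by (cases "i = 1"; cases "i = 2") (simp_all add: cont continuous_on_diff)
  qed
  ultimately show ?thesis by simp
qed

text \<open>The sum of the nonnegative terms \<open>lam j * (w \<bullet> e j)^2\<close> is
  \<open>|K w|^2\<close>, at most \<open>C^2\<close>. The lower bound on \<open>lam 1\<close> comes
  from \<open>1 = lam 1 * lam 2 * lam 3 \<le> (lam 1)^2 * lam 3\<close>, multiplied by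
  \<open>|w|^2\<close> and combined with the bound on \<open>lam 3 * |w|^2\<close>.\<close>

lemma ordered_eigensystem_bounds:
  assumes eig: "ordered_eigensystem (transpose K ** K) lam e" and det: "det K = 1"
    and C: "norm (K *v w) \<le> C"
  shows "lam j * (w \<bullet> e j)\<^sup>2 \<le> C\<^sup>2" "lam 3 * (norm w)\<^sup>2 \<le> C\<^sup>2" "norm w \<le> C * lam 1" "1 \<le> lam 1"
proof -
  note expand = ordered_eigensystem_expansion[OF eig]
  have ord: "lam 1 \<ge> lam 2" "lam 2 \<ge> lam 3" "lam 3 > 0"
    using eig by (auto simp: ordered_eigensystem_def)
  then have pos: "lam j > 0" for j using exhaust_3[of j] by auto
  have "(norm (K *v w))\<^sup>2 \<le> C\<^sup>2" by (rule power_mono[OF C]) simp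
  then have sum: "(\<Sum>j\<in>UNIV. lam j * (w \<bullet> e j)\<^sup>2) \<le> C\<^sup>2" by (simp add: expand(1))
  moreover have "lam j * (w \<bullet> e j)\<^sup>2 \<le> (\<Sum>j\<in>UNIV. lam j * (w \<bullet> e j)\<^sup>2)"
    using pos by (intro member_le_sum) (auto simp: less_imp_le)
  ultimately show "lam j * (w \<bullet> e j)\<^sup>2 \<le> C\<^sup>2" by simp
  have "lam 3 * (norm w)\<^sup>2 = (\<Sum>j\<in>UNIV. lam 3 * (w \<bullet> e j)\<^sup>2)"
    by (simp add: expand(2)[symmetric] sum_distrib_left)
  also have "\<dots> \<le> (\<Sum>j\<in>UNIV. lam j * (w \<bullet> e j)\<^sup>2)"
    using ord by (intro sum_mono mult_right_mono) (metis exhaust_3 order_refl order_trans, simp)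
  finally show lam3: "lam 3 * (norm w)\<^sup>2 \<le> C\<^sup>2" using sum by simp
  have prod: "lam 1 * lam 2 * lam 3 = 1" using expand(3) det by simp
  have "lam 1 * lam 2 * lam 3 \<le> lam 1 * lam 1 * lam 3"
    using ord pos by (intro mult_right_mono mult_left_mono) (auto simp: less_imp_le)
  then have lam13: "1 \<le> (lam 1)\<^sup>2 * lam 3" by (simp add: prod power2_eq_square)
  show "1 \<le> lam 1"
  proof (rule ccontr)
    assume "\<not> 1 \<le> lam 1"
    then have "lam 1 * lam 2 < 1" "lam 3 < 1"
      using ord pos[of 2] mult_strict_mono[of "lam 1" 1 "lam 2" 1] by auto
    then have "lam 1 * lam 2 * lam 3 < 1"
      using pos[of 3] mult_strict_mono[of "lam 1 * lam 2" 1 "lam 3" 1] by auto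
    with prod show False by simp
  qed
  have "(norm w)\<^sup>2 \<le> (lam 1)\<^sup>2 * lam 3 * (norm w)\<^sup>2"
    using mult_right_mono[OF lam13, of "(norm w)\<^sup>2"] by simp
  also have "\<dots> \<le> (lam 1)\<^sup>2 * C\<^sup>2"
    unfolding mult.assoc by (intro mult_left_mono lam3) simp
  finally have "(norm w)\<^sup>2 \<le> (C * lam 1)\<^sup>2" by (simp add: power_mult_distrib mult.commute)
  moreover have "0 \<le> C" using norm_ge_zero C by (rule order_trans)
  then have "0 \<le> C * lam 1" using pos[of 1] by simp
  ultimately show "norm w \<le> C * lam 1" by (rule power2_le_imp_le)
qed

section \<open>Limits along the blow-up sequence\<close>

theorem theorem2p3:
  fixes T :: ereal
    and v0 :: "real^3 \<Rightarrow> real^3"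
    and v :: "real^3 \<Rightarrow> real \<Rightarrow> real^3"
    and p :: "real^3 \<Rightarrow> real \<Rightarrow> real"
    and X A \<omega> \<xi> :: "real^3 \<Rightarrow> real \<Rightarrow> real^3"
    and lam :: "3 \<Rightarrow> real^3 \<Rightarrow> real \<Rightarrow> real"
    and e :: "3 \<Rightarrow> real^3 \<Rightarrow> real \<Rightarrow> real^3"
    and x :: "nat \<Rightarrow> real^3" and t :: "nat \<Rightarrow> real"
    and xbar :: "real^3" and tbar :: ereal
  assumes "0 < T"
    and "smooth_euler_solution T v0 v p"
    and "Linf_norm (curl v0) < \<infinity>"
    and "\<omega> = vorticity v"
    and "\<xi> = vorticity_direction v"
    and "trajectory_map T v X"
    and "\<And>s. s \<in> time_interval T \<Longrightarrow> diffeo (\<lambda>a. X a s)"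
    and "A = back_to_label X"
    and "\<And>y s. s \<in> time_interval T \<Longrightarrow>
           ordered_eigensystem (label_metric A y s) (\<lambda>j. lam j y s) (\<lambda>j. e j y s)"
    and "\<And>k. t k \<in> time_interval T"
    and "0 \<le> tbar" and "tbar \<le> T"
    and "x \<longlonglongrightarrow> xbar"
    and "(\<lambda>k. ereal (t k)) \<longlonglongrightarrow> tbar"
    and "filterlim (\<lambda>k. norm (\<omega> (x k) (t k))) at_top sequentially"
  shows "filterlim (\<lambda>k. lam 1 (x k) (t k)) at_top sequentially \<and>
         (\<lambda>k. lam 3 (x k) (t k)) \<longlonglongrightarrow> 0 \<and>
         (\<lambda>k. \<xi> (x k) (t k) \<bullet> e 1 (x k) (t k)) \<longlonglongrightarrow> 0 \<and>
         (liminf (\<lambda>k. ereal (lam 2 (x k) (t k))) > 0 \<longrightarrow>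
            (\<lambda>k. \<xi> (x k) (t k) \<bullet> e 2 (x k) (t k)) \<longlonglongrightarrow> 0)"
proof -
  \<comment> \<open>One constant must serve all labels, since the particle found at
    \<open>x k\<close> at time \<open>t k\<close> varies with \<open>k\<close>.\<close>
  obtain C where C: "C \<ge> 1" "\<And>x. norm (curl v0 x) \<le> C"
    using Linf_norm_bound[OF initial_vorticity_continuous[OF assms(2,1)] assms(3)] by blast
  define w where "w k = \<omega> (x k) (t k)" for k
  define n where "n k = norm (w k)" for k
  have n_top: "filterlim n at_top sequentially"
    using assms(15) unfolding n_def w_def .
  \<comment> \<open>The vorticity may vanish for finitely many \<open>k\<close>, so estimates
    dividing by \<open>n k\<close> hold eventually.\<close>
  then have n_pos: "\<forall>\<^sub>F k in sequentially. n k > 0"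
    by (simp add: filterlim_at_top_dense)
  have bounds: "lam j (x k) (t k) * (w k \<bullet> e j (x k) (t k))\<^sup>2 \<le> C\<^sup>2"
    "lam 3 (x k) (t k) * (n k)\<^sup>2 \<le> C\<^sup>2" "n k \<le> C * lam 1 (x k) (t k)" "1 \<le> lam 1 (x k) (t k)"
    "lam 3 (x k) (t k) > 0" for j k
  proof -
    let ?K = "jacobian (\<lambda>y. A y (t k)) (at (x k))"
    have eig: "ordered_eigensystem (transpose ?K ** ?K) (\<lambda>j. lam j (x k) (t k)) (\<lambda>j. e j (x k) (t k))"
      using assms(9)[OF assms(10)] by (simp only: label_metric_def Let_def)
    have "?K *v w k = curl v0 (A (x k) (t k))" and det: "det ?K = 1"
      using cauchy_vorticity_formula[OF assms(2,6,7,10)] by (simp_all only: assms(4,8) w_def)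
    then have "norm (?K *v w k) \<le> C" by (simp only: C(2))
    note * = ordered_eigensystem_bounds[OF eig det this]
    show "lam j (x k) (t k) * (w k \<bullet> e j (x k) (t k))\<^sup>2 \<le> C\<^sup>2" by (rule *(1))
    show "lam 3 (x k) (t k) * (n k)\<^sup>2 \<le> C\<^sup>2" "n k \<le> C * lam 1 (x k) (t k)"
      "1 \<le> lam 1 (x k) (t k)" unfolding n_def by (rule *)+
    show "lam 3 (x k) (t k) > 0" using eig by (simp add: ordered_eigensystem_def)
  qed
  have lam1: "filterlim (\<lambda>k. lam 1 (x k) (t k)) at_top sequentially"
  proof (rule filterlim_at_top_mono)
    show "filterlim (\<lambda>k. inverse C * n k) at_top sequentially"
      using C(1) by (intro filterlim_tendsto_pos_mult_at_top[OF tendsto_const _ n_top]) auto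
    show "\<forall>\<^sub>F k in sequentially. inverse C * n k \<le> lam 1 (x k) (t k)"
      using bounds(3) C(1) by (auto simp: field_simps)
  qed
  have quot: "(\<lambda>k. D / n k) \<longlonglongrightarrow> 0" for D :: real
    by (rule tendsto_divide_0[OF tendsto_const filterlim_at_top_imp_at_infinity[OF n_top]])
  have lam3: "(\<lambda>k. lam 3 (x k) (t k)) \<longlonglongrightarrow> 0"
  proof (rule Lim_null_comparison)
    show "(\<lambda>k. (C / n k) * (C / n k)) \<longlonglongrightarrow> 0" using tendsto_mult[OF quot quot] by simp
    show "\<forall>\<^sub>F k in sequentially. norm (lam 3 (x k) (t k)) \<le> (C / n k) * (C / n k)"
      using n_pos
    proof eventually_elim
      case (elim k)
      then show ?case using bounds(2,5)[of k] by (simp add: field_simps power2_eq_square)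
    qed
  qed
  \<comment> \<open>A component of \<open>w k\<close> that stays bounded is negligible after
    division by \<open>n k\<close>. It remains to bound the components along \<open>e 1\<close> and
    \<open>e 2\<close>.\<close>
  have direction: "(\<lambda>k. \<xi> (x k) (t k) \<bullet> f k) \<longlonglongrightarrow> 0"
    if "\<forall>\<^sub>F k in sequentially. (w k \<bullet> f k)\<^sup>2 \<le> D" for f :: "nat \<Rightarrow> real^3" and D
  proof (rule Lim_null_comparison[OF _ quot])
    show "\<forall>\<^sub>F k in sequentially. norm (\<xi> (x k) (t k) \<bullet> f k) \<le> sqrt D / n k"
      using that n_pos
    proof eventually_elim
      case (elim k)
      have "\<xi> (x k) (t k) \<bullet> f k = (w k \<bullet> f k) / n k"
        by (simp add: assms(4,5) vorticity_direction_def w_def n_def divide_inverse mult.commute)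
      moreover have "\<bar>w k \<bullet> f k\<bar> \<le> sqrt D" using real_sqrt_le_mono[OF elim(1)] by simp
      ultimately show ?case using elim(2) by (simp add: divide_right_mono)
    qed
  qed
  \<comment> \<open>Here \<open>lam 1 \<ge> 1\<close> removes the weight from the first term of the
    eigenvalue sum.\<close>
  have "(w k \<bullet> e 1 (x k) (t k))\<^sup>2 \<le> C\<^sup>2" for k
    using mult_right_mono[OF bounds(4)[of k], of "(w k \<bullet> e 1 (x k) (t k))\<^sup>2"] bounds(1)[of 1 k] by simp
  then have xi1: "(\<lambda>k. \<xi> (x k) (t k) \<bullet> e 1 (x k) (t k)) \<longlonglongrightarrow> 0"
    by (intro direction[of _ "C\<^sup>2"]) simp
  have xi2: "(\<lambda>k. \<xi> (x k) (t k) \<bullet> e 2 (x k) (t k)) \<longlonglongrightarrow> 0"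
    if liminf: "liminf (\<lambda>k. ereal (lam 2 (x k) (t k))) > 0"
  proof -
    \<comment> \<open>An eventual positive lower bound for \<open>lam 2\<close> takes the place of
      the bound \<open>lam 1 \<ge> 1\<close> used for \<open>e 1\<close>.\<close>
    obtain c where c: "c > 0" "ereal c < liminf (\<lambda>k. ereal (lam 2 (x k) (t k)))"
      using ereal_dense2[OF liminf] by (auto simp: zero_ereal_def)
    from less_LiminfD[OF c(2)] have "\<forall>\<^sub>F k in sequentially. (w k \<bullet> e 2 (x k) (t k))\<^sup>2 \<le> C\<^sup>2 / c"
    proof eventually_elim
      case (elim k)
      then have "c * (w k \<bullet> e 2 (x k) (t k))\<^sup>2 \<le> lam 2 (x k) (t k) * (w k \<bullet> e 2 (x k) (t k))\<^sup>2"
        by (intro mult_right_mono) auto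
      with bounds(1)[of 2 k] c(1) show ?case by (simp add: field_simps)
    qed
    then show ?thesis by (rule direction)
  qed
  from lam1 lam3 xi1 xi2 show ?thesis by blast
qed

end
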